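(* Let $n\ge 3$, let $\Omega\subset\mathbb{R}^n$ be a bounded domain with smooth boundary, and let $u$ solve $\Delta u=-n$ in $\Omega$, $u=0$ on $\partial\Omega$. Let $N$ be a connected component of $\Omega\setminus\mathrm{MAX}(u)$. Then the expected core radius $R(u,N)$ is well-defined (i.e. $\tau(u,N)\ge 1$, so that $\tau(u,N)$ lies in the range of $\tau_1$ or $\tau_2$) and $R(u,N)\ge 0$. Moreover, $R(u,N)=0$ if and only if $(\Omega,u)$ is equivalent to the Serrin solution $(\Omega_0,u_0)$, where $\Omega_0=B_1(0)$ and $u_0(x)=\frac{1-|x|^2}{2}$.
   Context: Notation: $u_{\max}=\max_{\Omega}u$ and $\mathrm{MAX}(u)=\{x\in\Omega: u(x)=u_{\max}\}$. Two solutions $(\Omega,u)$, $(\bar\Omega,\bar u)$ of this problem are equivalent if there are $\lambda>0$, $c\in\mathbb{R}^n$ with $\bar\Omega=\{\lambda x+c: x\in\Omega\}$ and $\bar u(y)=\lambda^2u((y-c)/\lambda)$. Normalized Wall Shear Stress (NWSS): for a connected component $S$ of $\partial\Omega$, $\tau(u,S)=\max_S|\nabla u|/\sqrt{2u_{\max}}$; for a connected component $N$ of $\Omega\setminus\mathrm{MAX}(u)$, $\tau(u,N)=\max\{\tau(u,S): S$ a connected component of $\partial\Omega\cap\overline N\}$ (this set of components is nonempty). Model solutions: let $R_{\max}=\sqrt{(n-2)/n}$. For $R\in(0,R_{\max})$ the function $f_R(r)=1-r^2-\frac{2R^n}{(n-2)r^{n-2}}$ has exactly two positive zeros $r_1=r_1(R)<R<r_2=r_2(R)$;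 the function $u_R(x)=\frac{1-|x|^2}{2}-\frac{R^n}{(n-2)|x|^{n-2}}$ solves the problem on $\Omega_R=\{r_1<|x|<r_2\}$, with maximum $(u_R)_{\max}=\frac12\big(1-\frac{n}{n-2}R^2\big)$ attained on $\{|x|=R\}$. For $R=0$ one takes $u_0$ above, with $r_2(0)=1$. Inner NWSS $\tau_1:(0,R_{\max}]\to[\sqrt n,+\infty)$: $\tau_1(R)=\frac{r_1(R^n/r_1^n-1)}{\sqrt{1-nR^2/(n-2)}}$ for $R<R_{\max}$, $\tau_1(R_{\max})=\sqrt n$; it is continuous, strictly decreasing, tends to $+\infty$ as $R\to0^+$. Outer NWSS $\tau_2:[0,R_{\max})\to[1,\sqrt n)$: $\tau_2(0)=1$, $\tau_2(R)=\frac{r_2(1-R^n/r_2^n)}{\sqrt{1-nR^2/(n-2)}}$ for $R>0$; it is continuous, strictly increasing, tends to $\sqrt n$ as $R\to R_{\max}$. Expected core radius: $R(u,N)=\tau_2^{-1}(\tau(u,N))$ if $\tau(u,N)<\sqrt n$ and $R(u,N)=\tau_1^{-1}(\tau(u,N))$ if $\tau(u,N)\ge\sqrt n$ (similarly $R(u,S)$ for a boundary component $S$). *)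

theory Defs
  imports "HOL-Analysis.Analysis"
begin

definition partial :: "'n::finite \<Rightarrow> (real^'n \<Rightarrow> real) \<Rightarrow> real^'n \<Rightarrow> real" where
  "partial i f x = frechet_derivative f (at x) (axis i 1)"

fun iter_partial :: "'n::finite list \<Rightarrow> (real^'n \<Rightarrow> real) \<Rightarrow> real^'n \<Rightarrow> real" where
  "iter_partial [] f = f"
| "iter_partial (i # is) f = partial i (iter_partial is f)"

definition grad :: "(real^'n::finite \<Rightarrow> real) \<Rightarrow> real^'n \<Rightarrow> real^'n" where
  "grad f x = (\<chi> i. partial i f x)"

definition laplacian :: "(real^'n::finite \<Rightarrow> real) \<Rightarrow> real^'n \<Rightarrow> real" where
  "laplacian f x = (\<Sum>i\<in>UNIV. partial i (partial i f) x)"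

definition smooth_on :: "(real^'n::finite) set \<Rightarrow> (real^'n \<Rightarrow> real) \<Rightarrow> bool" where
  "smooth_on U f \<longleftrightarrow> open U \<and> (\<forall>is. \<forall>x\<in>U. iter_partial is f differentiable (at x))"

definition smooth_bounded_domain :: "(real^'n::finite) set \<Rightarrow> bool" where
  "smooth_bounded_domain \<Omega> \<longleftrightarrow> open \<Omega> \<and> connected \<Omega> \<and> bounded \<Omega> \<and> \<Omega> \<noteq> {} \<and>
     (\<forall>p\<in>frontier \<Omega>. \<exists>U \<phi>. open U \<and> p \<in> U \<and> smooth_on U \<phi> \<and>
        (\<forall>x\<in>U. grad \<phi> x \<noteq> 0) \<and> \<Omega> \<inter> U = {x\<in>U. \<phi> x < 0})"

definition torsion_solution :: "(real^'n::finite) set \<Rightarrow> (real^'n \<Rightarrow> real) \<Rightarrow> bool" where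
  "torsion_solution \<Omega> u \<longleftrightarrow>
     (\<forall>x\<in>\<Omega>. u differentiable (at x)) \<and>
     (\<forall>i. \<forall>x\<in>\<Omega>. partial i u differentiable (at x)) \<and>
     (\<forall>i j. continuous_on \<Omega> (partial i (partial j u))) \<and>
     (\<exists>G. continuous_on (closure \<Omega>) G \<and> (\<forall>x\<in>\<Omega>. G x = grad u x)) \<and>
     continuous_on (closure \<Omega>) u \<and>
     (\<forall>x\<in>frontier \<Omega>. u x = 0) \<and>
     (\<forall>x\<in>\<Omega>. laplacian u x = - real CARD('n))"

definition umax :: "(real^'n::finite) set \<Rightarrow> (real^'n \<Rightarrow> real) \<Rightarrow> real" where
  "umax \<Omega> u = Sup (u ` \<Omega>)"

definition MAXset :: "(real^'n::finite) set \<Rightarrow> (real^'n \<Rightarrow> real) \<Rightarrow> (real^'n) set" where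
  "MAXset \<Omega> u = {x\<in>\<Omega>. u x = umax \<Omega> u}"

text \<open>Gradient at a boundary point: the limit of the interior gradient (exists for C^1 up to the boundary).\<close>
definition bgrad :: "(real^'n::finite) set \<Rightarrow> (real^'n \<Rightarrow> real) \<Rightarrow> real^'n \<Rightarrow> real^'n" where
  "bgrad \<Omega> u p = Lim (at p within \<Omega>) (grad u)"

definition nwss_bdry :: "(real^'n::finite) set \<Rightarrow> (real^'n \<Rightarrow> real) \<Rightarrow> (real^'n) set \<Rightarrow> real" where
  "nwss_bdry \<Omega> u S = Sup ((\<lambda>p. norm (bgrad \<Omega> u p)) ` S) / sqrt (2 * umax \<Omega> u)"

definition nwss :: "(real^'n::finite) set \<Rightarrow> (real^'n \<Rightarrow> real) \<Rightarrow> (real^'n) set \<Rightarrow> real" where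
  "nwss \<Omega> u N = Sup ((\<lambda>S. nwss_bdry \<Omega> u S) ` components (frontier \<Omega> \<inter> closure N))"

definition fR :: "nat \<Rightarrow> real \<Rightarrow> real \<Rightarrow> real" where
  "fR n R r = 1 - r^2 - 2 * R^n / ((real n - 2) * r^(n-2))"

definition r1 :: "nat \<Rightarrow> real \<Rightarrow> real" where
  "r1 n R = (THE r. 0 < r \<and> r < R \<and> fR n R r = 0)"

definition r2 :: "nat \<Rightarrow> real \<Rightarrow> real" where
  "r2 n R = (THE r. R < r \<and> 0 < r \<and> fR n R r = 0)"

definition Rmax :: "nat \<Rightarrow> real" where
  "Rmax n = sqrt ((real n - 2) / real n)"

definition tau1 :: "nat \<Rightarrow> real \<Rightarrow> real" where
  "tau1 n R = (if R = Rmax n then sqrt (real n)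
     else r1 n R * (R^n / (r1 n R)^n - 1) / sqrt (1 - real n * R^2 / (real n - 2)))"

definition tau2 :: "nat \<Rightarrow> real \<Rightarrow> real" where
  "tau2 n R = (if R = 0 then 1
     else r2 n R * (1 - R^n / (r2 n R)^n) / sqrt (1 - real n * R^2 / (real n - 2)))"

definition core_radius :: "nat \<Rightarrow> real \<Rightarrow> real" where
  "core_radius n t = (if t < sqrt (real n)
     then (THE R. 0 \<le> R \<and> R < Rmax n \<and> tau2 n R = t)
     else (THE R. 0 < R \<and> R \<le> Rmax n \<and> tau1 n R = t))"

definition equivalent_sol :: "(real^'n::finite) set \<Rightarrow> (real^'n \<Rightarrow> real) \<Rightarrow>
    (real^'n) set \<Rightarrow> (real^'n \<Rightarrow> real) \<Rightarrow> bool" where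
  "equivalent_sol \<Omega> u \<Omega>' u' \<longleftrightarrow> (\<exists>s::real. \<exists>c. s > 0 \<and>
     \<Omega>' = (\<lambda>x. s *\<^sub>R x + c) ` \<Omega> \<and>
     (\<forall>y\<in>\<Omega>'. u' y = s^2 * u ((1/s) *\<^sub>R (y - c))))"

definition serrin_u :: "real^'n::finite \<Rightarrow> real" where
  "serrin_u x = (1 - (norm x)^2) / 2"

end

theory Submission
  imports Defs
begin

text \<open>The function \<open>P = |grad u|\<^sup>2 + 2 u\<close> is subharmonic. It equals \<open>2 umax\<close> on the maximum set, and if
  \<open>\<tau>(u, N) \<le> 1\<close> it is at most \<open>2 umax\<close> on the rest of the boundary of \<open>N\<close>; hence
  \<open>|grad u|\<^sup>2 \<le> 2 (umax - u)\<close> on \<open>N\<close>. Expanding this to second order at a maximum point \<open>p\<close> touched by a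
  ball inside \<open>N\<close> and using that the Hessian there has trace \<open>- n\<close> shows that the Hessian is minus the
  identity. Then \<open>p\<close> is an isolated maximum, and the harmonic function \<open>g = umax - u - |x - p|\<^sup>2 / 2\<close>
  satisfies \<open>(x - p) \<bullet> grad g \<le> g\<close>. So \<open>g\<close> is nonpositive near \<open>p\<close>, hence zero by the strong maximum
  principle, and this propagates outwards through balls around \<open>p\<close> until the boundary is met: \<open>\<Omega>\<close> is a
  ball and \<open>\<tau>(u, N) = 1\<close>. Consequently \<open>\<tau>(u, N) \<ge> 1\<close> always, with equality only for the Serrin
  solution.\<close>

section \<open>Maximum principles\<close>

text \<open>On the Serrin solution \<open>P\<close> is the constant \<open>2 umax\<close>, so it
  detects deviation from that solution. Formally its Laplacian is 2 |D^2 u|^2 - 2 n, and |D^2 u|^2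
  \<ge> (trace D^2 u)^2 / n = n by Cauchy-Schwarz. At the touching point the expansion reads H^2 + H
  \<le> 0 for the Hessian H: its eigenvalues lie in [-1, 0], and the trace - n leaves only -1. The
  bound \<tau>(u, N) \<ge> 1 is obtained indirectly: a value at most 1 forces a ball, and on a ball
  the value is computed to be exactly 1. The core radius is a definite description, so
  \<open>tau2\<close> and \<open>tau1\<close> must be inverted uniquely, although the radii
  \<open>r1\<close> and \<open>r2\<close> in them are only implicit. The ratio q = r / R determines
  R, and in terms of q the inversion amounts to counting zeros of one explicit function, which
  Rolle's theorem does.\<close>

definition has_pd :: "'n::finite \<Rightarrow> (real^'n \<Rightarrow> real) \<Rightarrow> real \<Rightarrow> real^'n \<Rightarrow> bool" where
  "has_pd i f D x \<longleftrightarrow> ((\<lambda>s. f (x + s *\<^sub>R axis i 1)) has_real_derivative D) (at 0)"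

lemma has_pd_along:
  assumes "has_pd i f D (x + s *\<^sub>R axis i 1)"
  shows "((\<lambda>s. f (x + s *\<^sub>R axis i 1)) has_real_derivative D) (at s)"
proof -
  have "((\<lambda>h. f (x + (h + s) *\<^sub>R axis i 1)) has_real_derivative D) (at 0)"
    using assms unfolding has_pd_def by (simp add: algebra_simps)
  then show ?thesis
    using DERIV_shift[of "\<lambda>s. f (x + s *\<^sub>R axis i 1)" D 0 s] by simp
qed

lemma differentiable_has_derivative_along:
  assumes "f differentiable (at (x + s *\<^sub>R v))"
  shows "((\<lambda>s. f (x + s *\<^sub>R v)) has_real_derivative frechet_derivative f (at (x + s *\<^sub>R v)) v) (at s)"
proof -
  let ?D = "frechet_derivative f (at (x + s *\<^sub>R v))"
  have D: "(f has_derivative ?D) (at (x + s *\<^sub>R v))"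
    using assms frechet_derivative_works by blast
  have "((\<lambda>s. x + s *\<^sub>R v) has_derivative (\<lambda>h. h *\<^sub>R v)) (at s)"
    by (auto intro!: derivative_eq_intros)
  from diff_chain_at[OF this D]
  have "((\<lambda>s. f (x + s *\<^sub>R v)) has_derivative (\<lambda>h. ?D (h *\<^sub>R v))) (at s)"
    by (simp add: o_def)
  moreover have "(\<lambda>h. ?D (h *\<^sub>R v)) = (*) (?D v)"
    using linear_frechet_derivative[OF assms] by (auto simp: linear_cmul mult.commute)
  ultimately show ?thesis
    by (simp add: has_field_derivative_def)
qed

text \<open>The passage from Frechet partials to one-variable derivatives along coordinate lines.
  The maximum arguments only look at such lines, and for them the sum, product and chain rules are
  those of one variable.\<close>

lemma has_pd_partial:
  assumes "f differentiable (at x)"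
  shows "has_pd i f (partial i f x) x"
  using differentiable_has_derivative_along[of f x 0 "axis i 1"] assms
  by (simp add: has_pd_def partial_def)

lemma frechet_derivative_eq_sum_partial:
  fixes v :: "real^'n::finite"
  assumes "f differentiable (at x)"
  shows "frechet_derivative f (at x) v = (\<Sum>i\<in>UNIV. v $ i * partial i f x)"
proof -
  let ?D = "frechet_derivative f (at x)"
  have l: "linear ?D" using linear_frechet_derivative[OF assms] .
  have "?D v = ?D (\<Sum>i\<in>UNIV. v $ i *\<^sub>R axis i 1)"
    by (simp add: basis_expansion flip: scalar_mult_eq_scaleR)
  also have "\<dots> = (\<Sum>i\<in>UNIV. v $ i * ?D (axis i 1))"
    by (simp add: linear_sum[OF l] linear_cmul[OF l])
  finally show ?thesis by (simp add: partial_def)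
qed

text \<open>If c were positive, \<open>\<phi>1\<close> would vanish at 0 and be positive just to the
  right of it, so \<open>\<phi>\<close> would rise above \<open>\<phi> 0\<close> there.\<close>

lemma second_derivative_test_max:
  fixes \<phi> :: "real \<Rightarrow> real"
  assumes d: "d > 0" and D1: "\<And>s. \<bar>s\<bar> < d \<Longrightarrow> (\<phi> has_real_derivative \<phi>1 s) (at s)"
    and D2: "(\<phi>1 has_real_derivative c) (at 0)"
    and mx: "\<And>s. \<bar>s\<bar> < d \<Longrightarrow> \<phi> s \<le> \<phi> 0"
  shows "c \<le> 0"
proof (rule ccontr)
  assume "\<not> c \<le> 0"
  then have c: "c > 0" by simp
  have "\<phi>1 0 = 0"
    by (rule DERIV_local_max[OF D1 d]) (use d mx in auto)
  with DERIV_pos_inc_right[OF D2 c] obtain e where e: "e > 0" "\<And>h. 0 < h \<Longrightarrow> h < e \<Longrightarrow> 0 < \<phi>1 h"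
    by auto
  define h where "h = min e d / 2"
  have h: "0 < h" "h < e" "h < d" using e d by (auto simp: h_def min_def)
  have "\<exists>z. z > 0 \<and> z < h \<and> \<phi> h - \<phi> 0 = (h - 0) * \<phi>1 z"
    by (rule MVT2) (use h in \<open>auto intro!: D1\<close>)
  then obtain z where "z > 0" "z < h" "\<phi> h - \<phi> 0 = h * \<phi>1 z" by auto
  with e(2)[of z] h have "\<phi> h > \<phi> 0" by (smt (verit) mult_pos_pos)
  with mx[of h] h show False by auto
qed

lemma has_pd_second_nonpos_at_max:
  fixes f :: "real^'n::finite \<Rightarrow> real"
  assumes U: "open U" "x \<in> U" and D1: "\<And>y. y \<in> U \<Longrightarrow> has_pd i f (f1 y) y"
    and D2: "has_pd i f1 c x" and mx: "\<And>y. y \<in> U \<Longrightarrow> f y \<le> f x"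
  shows "c \<le> 0"
proof -
  obtain d where d: "d > 0" "ball x d \<subseteq> U" using U open_contains_ball by blast
  have inU: "x + s *\<^sub>R axis i 1 \<in> U" if "\<bar>s\<bar> < d" for s
  proof -
    have "x + s *\<^sub>R axis i 1 \<in> ball x d"
      using that by (simp add: dist_norm norm_axis_1)
    then show ?thesis using d by blast
  qed
  show ?thesis
    by (rule second_derivative_test_max[of d "\<lambda>s. f (x + s *\<^sub>R axis i 1)" "\<lambda>s. f1 (x + s *\<^sub>R axis i 1)" c])
       (use d D2 inU in \<open>auto intro!: has_pd_along D1 mx simp: has_pd_def\<close>)
qed

section \<open>Calculus of coordinate derivatives\<close>

lemma has_pd_add: "has_pd i f a x \<Longrightarrow> has_pd i g b x \<Longrightarrow> has_pd i (\<lambda>x. f x + g x) (a + b) x"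
  unfolding has_pd_def by (auto intro!: derivative_eq_intros)

lemma has_pd_diff: "has_pd i f a x \<Longrightarrow> has_pd i g b x \<Longrightarrow> has_pd i (\<lambda>x. f x - g x) (a - b) x"
  unfolding has_pd_def by (auto intro!: derivative_eq_intros)

lemma has_pd_minus: "has_pd i f a x \<Longrightarrow> has_pd i (\<lambda>x. - f x) (- a) x"
  unfolding has_pd_def by (auto intro!: derivative_eq_intros)

lemma has_pd_cmult: "has_pd i f a x \<Longrightarrow> has_pd i (\<lambda>x. c * f x) (c * a) x"
  unfolding has_pd_def by (auto intro!: derivative_eq_intros)

lemma has_pd_mult:
  "has_pd i f a x \<Longrightarrow> has_pd i g b x \<Longrightarrow> has_pd i (\<lambda>x. f x * g x) (a * g x + f x * b) x"
  unfolding has_pd_def by (auto intro!: derivative_eq_intros)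

lemma has_pd_const: "has_pd i (\<lambda>x. c) 0 x"
  unfolding has_pd_def by (auto intro!: derivative_eq_intros)

lemma has_pd_sum:
  "(\<And>k. k \<in> A \<Longrightarrow> has_pd i (f k) (a k) x) \<Longrightarrow> has_pd i (\<lambda>x. \<Sum>k\<in>A. f k x) (\<Sum>k\<in>A. a k) x"
  unfolding has_pd_def by (auto intro!: DERIV_sum)

lemma has_pd_exp: "has_pd i f a x \<Longrightarrow> has_pd i (\<lambda>x. exp (f x)) (exp (f x) * a) x"
  unfolding has_pd_def by (auto intro!: derivative_eq_intros)

lemma has_pd_component: "has_pd i (\<lambda>x. x $ i - y $ i) 1 x"
  unfolding has_pd_def by (auto intro!: derivative_eq_intros)

lemma has_pd_norm2:
  fixes x y :: "real^'n::finite"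
  shows "has_pd i (\<lambda>x. (norm (x - y))\<^sup>2) (2 * (x $ i - y $ i)) x"
proof -
  have *: "(norm (z + s *\<^sub>R axis i 1))\<^sup>2 = (norm z)\<^sup>2 + 2 * s * z $ i + s\<^sup>2" for z :: "real^'n" and s
    unfolding power2_norm_eq_inner
    by (simp add: inner_add_left inner_add_right inner_axis inner_axis' power2_eq_square algebra_simps)
  have "(norm (x + s *\<^sub>R axis i 1 - y))\<^sup>2 = (norm (x - y))\<^sup>2 + 2 * s * (x $ i - y $ i) + s\<^sup>2" for s
    using *[of "x - y" s] by (simp add: algebra_simps)
  then show ?thesis unfolding has_pd_def by (auto intro!: derivative_eq_intros)
qed

lemma has_pd_translate: "has_pd i f a (x + y) \<Longrightarrow> has_pd i (\<lambda>x. f (x + y)) a x"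
  unfolding has_pd_def by (simp add: algebra_simps)

section \<open>Difference quotients and the P-function\<close>

text \<open>By the mean value theorem the quotient is a value of \<open>f1\<close> at distance less
  than t, and \<open>f1\<close> is uniformly continuous on a compact neighbourhood of
  \<open>K\<close>.\<close>

lemma difference_quotient_uniform:
  fixes f :: "real^'n::finite \<Rightarrow> real"
  assumes \<Omega>: "open \<Omega>" and K: "compact K" "K \<subseteq> \<Omega>"
    and D: "\<And>x. x \<in> \<Omega> \<Longrightarrow> has_pd i f (f1 x) x" and c: "continuous_on \<Omega> f1" and e: "e > 0"
  shows "\<exists>d>0. \<forall>t. 0 < t \<and> t < d \<longrightarrow> (\<forall>x\<in>K. x + t *\<^sub>R axis i 1 \<in> \<Omega> \<and>
            \<bar>(f (x + t *\<^sub>R axis i 1) - f x) / t - f1 x\<bar> < e)"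
proof -
  obtain r where r: "r > 0" "(\<Union>x\<in>K. cball x r) \<subseteq> \<Omega>"
    using compact_subset_open_imp_cball_epsilon_subset[OF K(1) \<Omega> K(2)] by blast
  let ?K = "\<Union>x\<in>K. cball x r"
  \<comment> \<open>The closed neighbourhood is the Minkowski sum of \<open>K\<close> with a closed
    ball, hence compact.\<close>
  have "?K = {x + y |x y. x \<in> K \<and> y \<in> cball 0 r}"
  proof safe
    fix x y assume "x \<in> K" "y \<in> cball x r"
    then show "\<exists>x' y'. y = x' + y' \<and> x' \<in> K \<and> y' \<in> cball 0 r"
      by (intro exI[of _ x] exI[of _ "y - x"]) (auto simp: dist_norm norm_minus_commute)
  qed (force simp: dist_norm)
  then have "compact ?K" using compact_sums[OF K(1) compact_cball[of 0 r]] by simp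
  then have "uniformly_continuous_on ?K f1"
    using compact_uniformly_continuous continuous_on_subset[OF c r(2)] by blast
  then obtain d where d: "d > 0" "\<And>x x'. x \<in> ?K \<Longrightarrow> x' \<in> ?K \<Longrightarrow> dist x' x < d \<Longrightarrow> dist (f1 x') (f1 x) < e"
    unfolding uniformly_continuous_on_def using e by metis
  show ?thesis
  proof (intro exI[of _ "min d r"] conjI allI impI ballI)
    show "min d r > 0" using d r by simp
    fix t x assume t: "0 < t \<and> t < min d r" and x: "x \<in> K"
    have mem: "x + s *\<^sub>R axis i 1 \<in> ?K" if "0 \<le> s" "s \<le> t" for s
    proof -
      have "x + s *\<^sub>R axis i 1 \<in> cball x r" using that t by (simp add: dist_norm norm_axis_1)
      then show ?thesis using x by blast
    qed
    then show "x + t *\<^sub>R axis i 1 \<in> \<Omega>" using t r(2) by (smt (verit) subsetD)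
    have "\<exists>z. z > 0 \<and> z < t \<and> f (x + t *\<^sub>R axis i 1) - f (x + 0 *\<^sub>R axis i 1) = (t - 0) * f1 (x + z *\<^sub>R axis i 1)"
      by (rule MVT2) (use t mem r(2) in \<open>auto intro!: has_pd_along D\<close>)
    then obtain z where z: "z > 0" "z < t" "f (x + t *\<^sub>R axis i 1) - f x = t * f1 (x + z *\<^sub>R axis i 1)"
      by auto
    have "dist (f1 (x + z *\<^sub>R axis i 1)) (f1 x) < e"
      by (rule d(2)) (use mem[of 0] mem[of z] z t in \<open>auto simp: dist_norm norm_axis_1\<close>)
    then show "\<bar>(f (x + t *\<^sub>R axis i 1) - f x) / t - f1 x\<bar> < e"
      using z t by (simp add: dist_real_def)
  qed
qed

text \<open>Only second derivatives of \<open>u\<close> are assumed to exist, so \<open>|grad u|\<^sup>2 + 2 u\<close> cannot be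
  differentiated twice. Its analogue with difference quotients can, and is almost subharmonic:
  \<open>z\<^sup>2 \<ge> - 2 z - 1\<close> applied to the diagonal second differences gives the lower bound.\<close>
lemma P_function_max_principle:
  fixes u :: "real^'n::finite \<Rightarrow> real"
  assumes \<Omega>: "open \<Omega>"
    and D1: "\<And>i x. x \<in> \<Omega> \<Longrightarrow> has_pd i u (u1 i x) x"
    and D2: "\<And>i x. x \<in> \<Omega> \<Longrightarrow> has_pd i (u1 i) (u2 i x) x"
    and cu: "continuous_on \<Omega> u" and c1: "\<And>i. continuous_on \<Omega> (u1 i)"
    and c2: "\<And>i. continuous_on \<Omega> (u2 i)"
    and lap: "\<And>x. x \<in> \<Omega> \<Longrightarrow> (\<Sum>i\<in>UNIV. u2 i x) = - real CARD('n)"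
    and V: "open V" "bounded V" "V \<subseteq> \<Omega>"
    and Pc: "continuous_on (closure V) P"
    and PV: "\<And>x. x \<in> V \<Longrightarrow> P x = (\<Sum>i\<in>UNIV. (u1 i x)\<^sup>2) + 2 * u x"
    and fr: "\<And>x. x \<in> frontier V \<Longrightarrow> P x \<le> M"
    and x0: "x0 \<in> V"
  shows "P x0 \<le> M"
proof (rule ccontr)
  assume "\<not> P x0 \<le> M"
  then have gap: "M < P x0" by simp
  obtain B where B: "B > 0" "\<And>x. x \<in> closure V \<Longrightarrow> norm x \<le> B"
    using bounded_closure[OF V(2)] bounded_pos by blast
  \<comment> \<open>The term \<delta> |x|^2 makes the subharmonicity strict; this \<delta> keeps it
    at most half of the gap P x0 - M on \<open>closure V\<close>.\<close>
  define \<delta> where "\<delta> = (P x0 - M) / (2 * B\<^sup>2)"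
  have \<delta>: "\<delta> > 0" using gap B by (simp add: \<delta>_def)
  have \<delta>B: "\<delta> * B\<^sup>2 = (P x0 - M) / 2" using B by (simp add: \<delta>_def)
  define F where "F = (\<lambda>x. P x + \<delta> * (norm x)\<^sup>2)"
  have Fc: "continuous_on (closure V) F" unfolding F_def by (intro continuous_intros Pc)
  \<comment> \<open>The level lies between M + gap / 2, which bounds \<open>F\<close> on the
    frontier, and M + gap, which is at most \<open>F x0\<close>. So the superlevel set
    \<open>K\<close> is compact inside \<open>V\<close>.\<close>
  define c where "c = M + 3/4 * (P x0 - M)"
  define K where "K = {x \<in> closure V. c \<le> F x}"
  have "closed K" unfolding K_def
    by (intro continuous_closed_preimage[OF Fc, of "{c..}", unfolded vimage_def Int_def, simplified] closed_closure closed_atLeast)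
  moreover have "bounded K" using bounded_closure[OF V(2)] unfolding K_def by (rule bounded_subset) auto
  ultimately have K: "compact K" by (simp add: compact_eq_bounded_closed)
  have KV: "K \<subseteq> V"
  proof
    fix x assume x: "x \<in> K"
    show "x \<in> V"
    proof (rule ccontr)
      assume "x \<notin> V"
      with x V(1) have "x \<in> frontier V" by (auto simp: K_def frontier_def interior_open)
      then have "P x \<le> M" by (rule fr)
      moreover have "\<delta> * (norm x)\<^sup>2 \<le> \<delta> * B\<^sup>2"
        using x B(2)[of x] \<delta> by (intro mult_left_mono power_mono) (auto simp: K_def)
      ultimately have "F x \<le> M + (P x0 - M) / 2" using \<delta>B unfolding F_def by linarith
      with x gap show False by (simp add: K_def c_def field_simps)
    qed
  qed
  have K\<Omega>: "K \<subseteq> \<Omega>" using KV V(3) by blast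
  have Fx0: "F x0 \<ge> P x0" using \<delta> by (simp add: F_def)
  have x0K: "x0 \<in> K" using x0 Fx0 gap closure_subset by (auto simp: K_def c_def field_simps)
  \<comment> \<open>\<open>\<eta>\<close> bounds the error of \<open>Ft\<close> against
    \<open>F\<close>. A maximum point of \<open>Ft\<close> over \<open>K\<close> loses at most 2
    \<eta> = gap / 8, so there \<open>F\<close> is still at least M + 7/8 gap and exceeds c.\<close>
  define \<eta> where "\<eta> = (P x0 - M) / 16"
  have \<eta>: "\<eta> > 0" using gap by (simp add: \<eta>_def)
  have "\<exists>C. \<forall>x\<in>K. \<forall>i. \<bar>u1 i x\<bar> \<le> C"
  proof -
    have "\<exists>C. \<forall>x\<in>K. \<bar>u1 i x\<bar> \<le> C" for i
    proof -
      have "compact (u1 i ` K)"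
        using compact_continuous_image continuous_on_subset[OF c1 K\<Omega>] K by blast
      then obtain C where "\<And>y. y \<in> u1 i ` K \<Longrightarrow> norm y \<le> C"
        using compact_imp_bounded bounded_iff by metis
      then show ?thesis by (intro exI[of _ C]) auto
    qed
    then obtain C where C: "\<And>i x. x \<in> K \<Longrightarrow> \<bar>u1 i x\<bar> \<le> C i" by metis
    have "\<bar>u1 i x\<bar> \<le> (\<Sum>j\<in>UNIV. \<bar>C j\<bar>)" if "x \<in> K" for i x
      using C[OF that, of i] member_le_sum[of i UNIV "\<lambda>j. \<bar>C j\<bar>"] by force
    then show ?thesis by blast
  qed
  then obtain C where C: "\<And>i x. x \<in> K \<Longrightarrow> \<bar>u1 i x\<bar> \<le> C" by blast
  have C0: "C \<ge> 0" using C[OF x0K, of undefined] by linarith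
  let ?n = "real CARD('n)"
  have n: "?n > 0" by simp
  \<comment> \<open>An error e \<le> 1 in a difference quotient changes its square by at most e (2 C
    + 1); the n coordinates together then change by at most \<eta>.\<close>
  define e where "e = min 1 (\<eta> / (?n * (2 * C + 1)))"
  have e: "0 < e" "e \<le> 1" "?n * (e * (2 * C + 1)) \<le> \<eta>"
  proof -
    have p: "?n * (2 * C + 1) > 0" using C0 by simp
    then show "0 < e" "e \<le> 1" using \<eta> by (auto simp: e_def)
    have "e \<le> \<eta> / (?n * (2 * C + 1))" by (simp add: e_def)
    then have "e * (?n * (2 * C + 1)) \<le> \<eta>" using p by (simp only: pos_le_divide_eq)
    then show "?n * (e * (2 * C + 1)) \<le> \<eta>" by (simp add: mult_ac)
  qed
  have "\<exists>d>0. \<forall>t. 0 < t \<and> t < d \<longrightarrow> (\<forall>x\<in>K. x + t *\<^sub>R axis i 1 \<in> \<Omega> \<and>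
            \<bar>(u (x + t *\<^sub>R axis i 1) - u x) / t - u1 i x\<bar> < e)" for i
    by (rule difference_quotient_uniform[OF \<Omega> K K\<Omega> D1 c1 e(1)])
  then obtain d where d: "\<And>i. d i > 0" "\<And>i t x. 0 < t \<Longrightarrow> t < d i \<Longrightarrow> x \<in> K \<Longrightarrow> x + t *\<^sub>R axis i 1 \<in> \<Omega> \<and>
            \<bar>(u (x + t *\<^sub>R axis i 1) - u x) / t - u1 i x\<bar> < e" by metis
  have "\<exists>d>0. \<forall>t. 0 < t \<and> t < d \<longrightarrow> (\<forall>x\<in>K. x + t *\<^sub>R axis i 1 \<in> \<Omega> \<and>
            \<bar>(u1 i (x + t *\<^sub>R axis i 1) - u1 i x) / t - u2 i x\<bar> < \<delta>/4)" for i
    by (rule difference_quotient_uniform[OF \<Omega> K K\<Omega> D2 c2]) (use \<delta> in auto)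
  then obtain d' where d': "\<And>i. d' i > 0" "\<And>i t x. 0 < t \<Longrightarrow> t < d' i \<Longrightarrow> x \<in> K \<Longrightarrow>
            \<bar>(u1 i (x + t *\<^sub>R axis i 1) - u1 i x) / t - u2 i x\<bar> < \<delta>/4" by metis
  define \<mu> where "\<mu> = Min (range (\<lambda>i. min (d i) (d' i)))"
  have m: "\<mu> > 0" using d(1) d'(1) unfolding \<mu>_def by (subst Min_gr_iff) auto
  have m': "\<mu> \<le> min (d i) (d' i)" for i unfolding \<mu>_def by (rule Min_le) auto
  define t where "t = \<mu> / 2"
  have t: "0 < t" "t < d i" "t < d' i" for i
    using m m'[of i] by (auto simp: t_def)
  define Q where "Q = (\<lambda>i x. (u (x + t *\<^sub>R axis i 1) - u x) / t)"
  define Q1 where "Q1 = (\<lambda>j i x. (u1 j (x + t *\<^sub>R axis i 1) - u1 j x) / t)"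
  define Q2 where "Q2 = (\<lambda>j i x. (u2 j (x + t *\<^sub>R axis i 1) - u2 j x) / t)"
  \<comment> \<open>The unsimplified shapes below (\<open>x - 0\<close>, \<open>Q * Q\<close>,
    \<open>2 * 1\<close>) are those that the \<open>has_pd\<close> rules produce, so both
    derivatives follow by plain introduction.\<close>
  define Ft where "Ft = (\<lambda>x. (\<Sum>i\<in>UNIV. Q i x * Q i x) + 2 * u x + \<delta> * (norm (x - 0))\<^sup>2)"
  define F1 where "F1 = (\<lambda>j x. (\<Sum>i\<in>UNIV. Q1 j i x * Q i x + Q i x * Q1 j i x) + 2 * u1 j x + \<delta> * (2 * (x $ j - 0 $ j)))"
  define F2 where "F2 = (\<lambda>j x. (\<Sum>i\<in>UNIV. Q2 j i x * Q i x + Q1 j i x * Q1 j i x + (Q1 j i x * Q1 j i x + Q i x * Q2 j i x)) + 2 * u2 j x + \<delta> * (2 * 1))"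
  have K\<Omega>t: "x + t *\<^sub>R axis i 1 \<in> \<Omega>" if "x \<in> K" for x i
    using d(2)[OF t(1) t(2) that] by blast
  have close: "\<bar>Ft x - F x\<bar> \<le> \<eta>" if "x \<in> K" for x
  proof -
    have "\<bar>Q i x * Q i x - (u1 i x)\<^sup>2\<bar> \<le> e * (2 * C + 1)" for i
    proof -
      have a: "\<bar>Q i x - u1 i x\<bar> < e" using d(2)[OF t(1) t(2) that] by (simp add: Q_def)
      have "Q i x * Q i x - (u1 i x)\<^sup>2 = (Q i x - u1 i x) * (Q i x + u1 i x)"
        by (simp add: algebra_simps power2_eq_square)
      moreover have "\<bar>Q i x + u1 i x\<bar> \<le> 2 * C + 1" using a C[OF that, of i] e(2) by linarith
      ultimately show ?thesis using a by (simp add: abs_mult mult_mono')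
    qed
    then have "(\<Sum>i\<in>UNIV. \<bar>Q i x * Q i x - (u1 i x)\<^sup>2\<bar>) \<le> of_nat (card (UNIV::'n set)) * (e * (2 * C + 1))"
      by (intro sum_bounded_above) auto
    moreover have "Ft x - F x = (\<Sum>i\<in>UNIV. Q i x * Q i x - (u1 i x)\<^sup>2)"
      using PV[of x] that KV by (auto simp: Ft_def F_def sum_subtractf)
    ultimately show ?thesis
      using e(3) sum_abs[of "\<lambda>i. Q i x * Q i x - (u1 i x)\<^sup>2" UNIV] by linarith
  qed
  have cQ: "continuous_on K (\<lambda>x. u (x + t *\<^sub>R axis i 1))" for i
    by (rule continuous_on_compose2[OF cu]) (use K\<Omega>t in \<open>auto intro!: continuous_intros\<close>)
  have "continuous_on K Ft" unfolding Ft_def Q_def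
    by (intro continuous_intros cQ continuous_on_subset[OF cu K\<Omega>]) (use t(1) in auto)
  then obtain y where y: "y \<in> K" "\<And>x. x \<in> K \<Longrightarrow> Ft x \<le> Ft y"
    using continuous_attains_sup[OF K] x0K by blast
  have "Ft y \<ge> P x0 - \<eta>" using y(2)[OF x0K] close[OF x0K] Fx0 by linarith
  moreover have "Ft y - F y \<le> \<eta>" using close[OF y(1)] by linarith
  ultimately have Fy: "F y > c" using gap by (simp add: \<eta>_def c_def field_simps)
  \<comment> \<open>The strict superlevel set is an open neighbourhood of y inside \<open>K\<close>,
    so y is an interior maximum of \<open>Ft\<close>.\<close>
  define U where "U = {x \<in> V. c < F x}"
  have "open U" unfolding U_def
    using continuous_open_preimage[OF continuous_on_subset[OF Fc closure_subset] V(1) open_greaterThan[of c]]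
    by (simp add: vimage_def Int_def)
  have yU: "y \<in> U" using y(1) KV Fy by (auto simp: U_def)
  have UK: "U \<subseteq> K" using closure_subset by (fastforce simp: U_def K_def)
  have Q_pd: "has_pd j (Q i) (Q1 j i x) x" if "x \<in> K" for x i j
  proof -
    have "has_pd j (\<lambda>x. (1/t) * (u (x + t *\<^sub>R axis i 1) - u x)) ((1/t) * (u1 j (x + t *\<^sub>R axis i 1) - u1 j x)) x"
      by (intro has_pd_cmult has_pd_diff has_pd_translate D1) (use that K\<Omega> K\<Omega>t in auto)
    then show ?thesis by (simp add: Q_def Q1_def)
  qed
  have Q1_pd: "has_pd j (Q1 j i) (Q2 j i x) x" if "x \<in> K" for x i j
  proof -
    have "has_pd j (\<lambda>x. (1/t) * (u1 j (x + t *\<^sub>R axis i 1) - u1 j x)) ((1/t) * (u2 j (x + t *\<^sub>R axis i 1) - u2 j x)) x"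
      by (intro has_pd_cmult has_pd_diff has_pd_translate D2) (use that K\<Omega> K\<Omega>t in auto)
    then show ?thesis by (simp add: Q2_def Q1_def)
  qed
  have "F2 j y \<le> 0" for j
  proof (rule has_pd_second_nonpos_at_max[OF \<open>open U\<close> yU, of j Ft "F1 j"])
    fix x assume "x \<in> U"
    then have x: "x \<in> K" "x \<in> \<Omega>" using UK K\<Omega> by auto
    then show "Ft x \<le> Ft y" using y(2) by blast
    show "has_pd j Ft (F1 j x) x" unfolding Ft_def F1_def
      by (intro has_pd_add has_pd_sum has_pd_mult has_pd_cmult has_pd_norm2 Q_pd D1 x)
  next
    have "y \<in> \<Omega>" using y(1) K\<Omega> by auto
    then show "has_pd j (F1 j) (F2 j y) y" unfolding F1_def F2_def
      by (intro has_pd_add has_pd_sum has_pd_mult has_pd_cmult Q_pd Q1_pd D2 y(1) has_pd_component)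
  qed
  then have "(\<Sum>j\<in>UNIV. F2 j y) \<le> 0" by (intro sum_nonpos) auto
  \<comment> \<open>The right-hand side equals n \<delta>: the squared differences give at least 2 n
    - n \<delta>, the term 2 u gives - 2 n, and the norm gives 2 \<delta> n.\<close>
  moreover have "(\<Sum>j\<in>UNIV. F2 j y) \<ge> 2 * (?n - ?n * (\<delta>/2)) - 2 * ?n + 2 * \<delta> * ?n"
  proof -
    \<comment> \<open>The Laplacian of u is constant, so the difference quotients of u are
      harmonic.\<close>
    have Q2z: "(\<Sum>j\<in>UNIV. Q2 j i y) = 0" for i
      using lap[OF K\<Omega>t[OF y(1)], of i] lap[of y] y(1) K\<Omega>
      by (auto simp: Q2_def sum_subtractf simp flip: sum_divide_distrib)
    have "(\<Sum>j\<in>UNIV. F2 j y) = (\<Sum>j\<in>UNIV. \<Sum>i\<in>UNIV. 2 * (Q i y * Q2 j i y)) + (\<Sum>j\<in>UNIV. \<Sum>i\<in>UNIV. 2 * (Q1 j i y)\<^sup>2)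
        + 2 * (\<Sum>j\<in>UNIV. u2 j y) + 2 * \<delta> * ?n"
      unfolding F2_def sum_distrib_left
      by (simp add: sum.distrib sum_distrib_left power2_eq_square algebra_simps)
    also have "(\<Sum>j\<in>UNIV. \<Sum>i\<in>UNIV. 2 * (Q i y * Q2 j i y)) = (\<Sum>i\<in>UNIV. 2 * Q i y * (\<Sum>j\<in>UNIV. Q2 j i y))"
      by (subst sum.swap) (simp add: sum_distrib_left mult.assoc)
    also have "\<dots> = 0" by (simp add: Q2z)
    also have "(\<Sum>j\<in>UNIV. u2 j y) = - ?n" using lap y(1) K\<Omega> by auto
    finally have 1: "(\<Sum>j\<in>UNIV. F2 j y) = (\<Sum>j\<in>UNIV. \<Sum>i\<in>UNIV. 2 * (Q1 j i y)\<^sup>2) - 2 * ?n + 2 * \<delta> * ?n" by simp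
    have "(\<Sum>i\<in>UNIV. 2 * (Q1 j i y)\<^sup>2) \<ge> - 4 * u2 j y - \<delta> - 2" for j
    proof -
      have "(\<Sum>i\<in>UNIV. 2 * (Q1 j i y)\<^sup>2) \<ge> 2 * (Q1 j j y)\<^sup>2"
        by (rule member_le_sum) auto
      moreover have "(Q1 j j y)\<^sup>2 \<ge> - 2 * Q1 j j y - 1"
        using zero_le_power2[of "Q1 j j y + 1"] by (simp add: power2_sum)
      moreover have "Q1 j j y \<le> u2 j y + \<delta>/4"
        using d'(2)[OF t(1) t(3) y(1), of j] unfolding Q1_def by linarith
      ultimately show ?thesis by linarith
    qed
    then have "(\<Sum>j\<in>UNIV. \<Sum>i\<in>UNIV. 2 * (Q1 j i y)\<^sup>2) \<ge> (\<Sum>j\<in>UNIV. - 4 * u2 j y - \<delta> - 2)"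
      by (intro sum_mono)
    also have "(\<Sum>j\<in>UNIV. - 4 * u2 j y - \<delta> - 2) = - 4 * (\<Sum>j\<in>UNIV. u2 j y) - ?n * \<delta> - 2 * ?n"
      by (simp add: sum_subtractf sum_negf flip: sum_distrib_left)
    also have "(\<Sum>j\<in>UNIV. u2 j y) = - ?n" using lap y(1) K\<Omega> by auto
    finally show ?thesis using 1 by (simp add: algebra_simps)
  qed
  moreover have "?n * \<delta> > 0" using \<delta> by simp
  ultimately show False by (simp add: algebra_simps)
qed

text \<open>Hopf's argument: near a boundary point of the zero set that is touched by a ball of negativity
  centred at \<open>y\<close>, adding a multiple of \<open>exp (- \<alpha> |x - y|\<^sup>2)\<close> creates an interior maximum with positive
  Laplacian.\<close>
lemma strong_max_principle:
  fixes g :: "real^'n::finite \<Rightarrow> real"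
  assumes B: "open B" "connected B"
    and D1: "\<And>i x. x \<in> B \<Longrightarrow> has_pd i g (g1 i x) x"
    and D2: "\<And>i x. x \<in> B \<Longrightarrow> has_pd i (g1 i) (g2 i x) x"
    and cg: "continuous_on B g"
    and lap: "\<And>x. x \<in> B \<Longrightarrow> (\<Sum>i\<in>UNIV. g2 i x) = 0"
    and le: "\<And>x. x \<in> B \<Longrightarrow> g x \<le> 0"
    and z: "z \<in> B" "g z = 0" and x: "x \<in> B"
  shows "g x = 0"
proof (rule ccontr)
  assume "g x \<noteq> 0"
  let ?n = "real CARD('n)"
  define Z where "Z = {x \<in> B. g x = 0}"
  have clo: "closedin (top_of_set B) Z" unfolding Z_def
    using continuous_closedin_preimage_constant[OF cg] by simp
  have "\<not> open Z"
  proof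
    assume "open Z"
    then have "openin (top_of_set B) Z" by (simp add: Z_def openin_open_eq B(1))
    then have "Z = {} \<or> Z = B" using clo B(2) connected_clopen by blast
    then show False using z x \<open>g x \<noteq> 0\<close> by (auto simp: Z_def)
  qed
  then obtain z0 where z0: "z0 \<in> Z" "\<And>e. e > 0 \<Longrightarrow> \<not> ball z0 e \<subseteq> Z"
    unfolding open_contains_ball by blast
  obtain d where d: "d > 0" "ball z0 d \<subseteq> B" using openE[OF B(1), of z0] z0(1) by (auto simp: Z_def)
  \<comment> \<open>With y0 within d/4 of z0 also R < d/4, so \<open>ball y0 R\<close> stays in
    \<open>cball z0 (d/2)\<close>, where \<open>Zc\<close> sees every zero of g.\<close>
  obtain y0 where y0: "y0 \<in> ball z0 (d/4)" "y0 \<notin> Z" using z0(2)[of "d/4"] d(1) by (metis subsetI zero_less_divide_iff zero_less_numeral)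
  define Zc where "Zc = {x \<in> cball z0 (d/2). g x = 0}"
  have cb: "cball z0 (d/2) \<subseteq> B" using d by (force intro: order_trans[OF _ d(2)])
  have "closed Zc" unfolding Zc_def
    by (rule continuous_closed_preimage_constant[OF continuous_on_subset[OF cg cb]]) simp
  moreover have z0Zc: "z0 \<in> Zc" using z0 d by (auto simp: Zc_def Z_def)
  ultimately obtain z1 where z1: "z1 \<in> Zc" "\<And>w. w \<in> Zc \<Longrightarrow> dist y0 z1 \<le> dist y0 w"
    using distance_attains_inf[of Zc y0] by blast
  define R where "R = dist y0 z1"
  have R: "R < d/4" using z1(2)[OF z0Zc] y0(1) by (simp add: R_def dist_commute)
  have "y0 \<noteq> z1" using y0 z1(1) cb by (auto simp: Zc_def Z_def)
  then have R0: "R > 0" by (simp add: R_def)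
  have neg0: "g w < 0" if "w \<in> ball y0 R" for w
  proof -
    have "dist z0 w \<le> dist z0 y0 + dist y0 w" by (rule dist_triangle)
    then have w: "w \<in> cball z0 (d/2)" using that y0(1) R by simp
    moreover have "w \<notin> Zc" using z1(2)[of w] that by (auto simp: R_def)
    ultimately show ?thesis using le[of w] cb by (force simp: Zc_def)
  qed
  \<comment> \<open>Halving the ball towards z1 leaves z1 as the only point of the closed ball at
    which g can vanish.\<close>
  define y where "y = midpoint y0 z1"
  define r where "r = R / 2"
  have r: "r > 0" using R0 by (simp add: r_def)
  have yz1: "dist y z1 = r" by (simp add: y_def r_def R_def dist_midpoint)
  have neg: "g w < 0" if "w \<in> cball y r" "w \<noteq> z1" for w
  proof (rule neg0)
    define a where "a = z1 - y"
    have a: "y - y0 = a" "norm a = r"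
      using yz1 by (auto simp: a_def y_def midpoint_def dist_norm norm_minus_commute algebra_simps
          simp flip: scaleR_add_left)
    define v where "v = w - y"
    have v: "norm v \<le> r" "v \<noteq> a" using that by (auto simp: v_def a_def dist_norm norm_minus_commute)
    \<comment> \<open>Parallelogram law: |v| \<le> r, |a| = r and v \<noteq> a give |v + a| < 2 r =
      R.\<close>
    have "(norm (v + a))\<^sup>2 + (norm (v - a))\<^sup>2 = 2 * (norm v)\<^sup>2 + 2 * (norm a)\<^sup>2"
      by (simp add: power2_norm_eq_inner algebra_simps inner_commute)
    moreover have "(norm v)\<^sup>2 \<le> r\<^sup>2" using v by (intro power_mono) auto
    moreover have "(norm (v - a))\<^sup>2 > 0" using v by simp
    ultimately have "(norm (v + a))\<^sup>2 < R\<^sup>2" using a by (simp add: r_def power2_eq_square)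
    then have "norm (v + a) < R" using R0 by (simp add: power2_less_imp_less)
    moreover have "w - y0 = v + a" using a(1) by (simp add: v_def algebra_simps)
    ultimately show "w \<in> ball y0 R" by (simp add: dist_norm norm_minus_commute)
  qed
  \<comment> \<open>This radius keeps the ball around z1 at distance at least r/2 from y.\<close>
  define \<rho> where "\<rho> = r / 2"
  have \<rho>: "\<rho> > 0" using r by (simp add: \<rho>_def)
  have cbz: "cball z1 \<rho> \<subseteq> B"
  proof
    fix w assume "w \<in> cball z1 \<rho>"
    then have "dist z0 w \<le> dist z0 z1 + \<rho>" using dist_triangle[of z0 w z1] by simp
    also have "\<dots> < d" using z1(1) R R0 by (simp add: Zc_def \<rho>_def r_def)
    finally show "w \<in> B" using d by auto
  qed
  have far: "dist w y \<ge> r / 2" if "w \<in> cball z1 \<rho>" for w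
    using that dist_triangle[of y z1 w] yz1 by (simp add: \<rho>_def dist_commute)
  \<comment> \<open>The Laplacian of exp (- \<alpha> |x - y|^2) is that exponential times 4
    \<alpha>^2 |x - y|^2 - 2 \<alpha> n. For |x - y| \<ge> r/2 this factor is at least \<alpha>
    (\<alpha> r^2 - 2 n), which the choice of \<alpha> makes equal to \<alpha>.\<close>
  define \<alpha> where "\<alpha> = (2 * ?n + 1) / r\<^sup>2"
  have \<alpha>: "\<alpha> > 0" using r by (simp add: \<alpha>_def add_pos_pos)
  define \<psi> where "\<psi> = (\<lambda>x. exp (- \<alpha> * (norm (x - y))\<^sup>2) - exp (- \<alpha> * r\<^sup>2))"
  define \<psi>1 where "\<psi>1 = (\<lambda>i x. exp (- \<alpha> * (norm (x - y))\<^sup>2) * (- \<alpha> * (2 * (x $ i - y $ i))) - 0)"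
  define \<psi>2 where "\<psi>2 = (\<lambda>i x. exp (- \<alpha> * (norm (x - y))\<^sup>2) * (- \<alpha> * (2 * (x $ i - y $ i))) * (- \<alpha> * (2 * (x $ i - y $ i)))
       + exp (- \<alpha> * (norm (x - y))\<^sup>2) * (- \<alpha> * (2 * 1)) - 0)"
  have P1: "has_pd i \<psi> (\<psi>1 i x) x" for i x unfolding \<psi>_def \<psi>1_def
    by (intro has_pd_diff has_pd_exp has_pd_cmult has_pd_norm2 has_pd_const)
  have P2: "has_pd i (\<psi>1 i) (\<psi>2 i x) x" for i x unfolding \<psi>1_def \<psi>2_def
    by (intro has_pd_diff has_pd_mult has_pd_exp has_pd_cmult has_pd_norm2 has_pd_const has_pd_component)
  have lap\<psi>: "(\<Sum>i\<in>UNIV. \<psi>2 i w) > 0" if "w \<in> cball z1 \<rho>" for w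
  proof -
    have nm: "(norm (w - y))\<^sup>2 = (\<Sum>i\<in>UNIV. (w $ i - y $ i)\<^sup>2)"
      unfolding power2_norm_eq_inner by (simp add: inner_vec_def power2_eq_square)
    let ?E = "exp (- \<alpha> * (norm (w - y))\<^sup>2)"
    have "\<psi>2 i w = ?E * (4 * \<alpha>\<^sup>2 * (w $ i - y $ i)\<^sup>2 - 2 * \<alpha>)" for i
      by (simp add: \<psi>2_def power2_eq_square algebra_simps)
    then have "(\<Sum>i\<in>UNIV. \<psi>2 i w) = ?E * (\<Sum>i\<in>UNIV. 4 * \<alpha>\<^sup>2 * (w $ i - y $ i)\<^sup>2 - 2 * \<alpha>)"
      by (simp add: sum_distrib_left)
    also have "(\<Sum>i\<in>UNIV. 4 * \<alpha>\<^sup>2 * (w $ i - y $ i)\<^sup>2 - 2 * \<alpha>) = 4 * \<alpha>\<^sup>2 * (norm (w - y))\<^sup>2 - 2 * \<alpha> * ?n"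
      by (simp add: sum_subtractf nm flip: sum_distrib_left)
    finally have eq: "(\<Sum>i\<in>UNIV. \<psi>2 i w) = ?E * (4 * \<alpha>\<^sup>2 * (norm (w - y))\<^sup>2 - 2 * \<alpha> * ?n)" .
    have "(r/2)\<^sup>2 \<le> (norm (w - y))\<^sup>2"
      using far[OF that] r by (intro power_mono) (auto simp: dist_norm)
    then have "4 * \<alpha>\<^sup>2 * (r/2)\<^sup>2 \<le> 4 * \<alpha>\<^sup>2 * (norm (w - y))\<^sup>2" by (intro mult_left_mono) auto
    moreover have "4 * \<alpha>\<^sup>2 * (r/2)\<^sup>2 = \<alpha> * (\<alpha> * r\<^sup>2)" by (simp add: power2_eq_square)
    moreover have "\<alpha> * r\<^sup>2 = 2 * ?n + 1" using r by (simp add: \<alpha>_def)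
    ultimately have "4 * \<alpha>\<^sup>2 * (norm (w - y))\<^sup>2 - 2 * \<alpha> * ?n \<ge> \<alpha>" by (simp add: algebra_simps)
    then show ?thesis unfolding eq using \<alpha> by (intro mult_pos_pos) auto
  qed
  \<comment> \<open>On this part of the sphere g is bounded away from 0 and \<open>\<psi>\<close> <
    1; on the rest \<open>\<psi>\<close> < 0 and g \<le> 0. So \<open>G\<close> is negative on the
    whole sphere although \<open>G z1 = 0\<close>, and its maximum is interior.\<close>
  let ?C = "sphere z1 \<rho> \<inter> cball y r"
  have CB: "?C \<subseteq> B" using cbz by (auto simp: subset_iff)
  have "\<exists>\<eta>>0. \<forall>w\<in>?C. g w \<le> - \<eta>"
  proof (cases "?C = {}")
    case True then show ?thesis by (intro exI[of _ 1]) auto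
  next
    case False
    have "compact ?C" by (intro compact_Int) auto
    then obtain m where m: "m \<in> ?C" "\<And>w. w \<in> ?C \<Longrightarrow> g w \<le> g m"
      using continuous_attains_sup[OF _ False continuous_on_subset[OF cg CB]] by blast
    have "m \<noteq> z1" using m(1) \<rho> by auto
    then have "g m < 0" using neg m(1) by blast
    then show ?thesis using m(2) by (intro exI[of _ "- g m"]) auto
  qed
  then obtain \<eta> where \<eta>: "\<eta> > 0" "\<And>w. w \<in> ?C \<Longrightarrow> g w \<le> - \<eta>" by blast
  define G where "G = (\<lambda>x. g x + \<eta> * \<psi> x)"
  have cG: "continuous_on (cball z1 \<rho>) G" unfolding G_def \<psi>_def
    by (intro continuous_intros continuous_on_subset[OF cg cbz])
  have "cball z1 \<rho> \<noteq> {}" using \<rho> by simp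
  then obtain m where m: "m \<in> cball z1 \<rho>" "\<And>w. w \<in> cball z1 \<rho> \<Longrightarrow> G w \<le> G m"
    using continuous_attains_sup[OF compact_cball _ cG] by blast
  have "norm (z1 - y) = r" using yz1 by (simp add: dist_norm norm_minus_commute)
  then have "G z1 = 0" using z1(1) by (simp add: G_def \<psi>_def Zc_def)
  then have Gm: "G m \<ge> 0" using m(2)[of z1] \<rho> by simp
  have "m \<in> ball z1 \<rho>"
  proof (rule ccontr)
    assume "m \<notin> ball z1 \<rho>"
    then have ms: "m \<in> sphere z1 \<rho>" using m(1) by simp
    show False
    proof (cases "m \<in> cball y r")
      case True
      have "\<psi> m < 1"
      proof -
        have "exp (- \<alpha> * (norm (m - y))\<^sup>2) \<le> 1" using \<alpha> by simp
        moreover have "exp (- \<alpha> * r\<^sup>2) > 0" by simp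
        ultimately show ?thesis unfolding \<psi>_def by linarith
      qed
      then have "\<eta> * \<psi> m < \<eta>" using \<eta>(1) by simp
      moreover have "g m \<le> - \<eta>" using \<eta>(2) True ms by blast
      ultimately show False using Gm by (simp add: G_def)
    next
      case False
      then have "r\<^sup>2 < (norm (m - y))\<^sup>2"
        using r by (intro power_strict_mono) (auto simp: dist_norm norm_minus_commute)
      then have "\<psi> m < 0" using \<alpha> by (simp add: \<psi>_def)
      then have "\<eta> * \<psi> m < 0" using \<eta>(1) by (simp add: mult_pos_neg)
      moreover have "g m \<le> 0" using le m(1) cbz by blast
      ultimately show False using Gm by (simp add: G_def)
    qed
  qed
  have "g2 i m + \<eta> * \<psi>2 i m \<le> 0" for i
  proof (rule has_pd_second_nonpos_at_max[OF open_ball \<open>m \<in> ball z1 \<rho>\<close>, of i G "\<lambda>x. g1 i x + \<eta> * \<psi>1 i x"])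
    fix w assume "w \<in> ball z1 \<rho>"
    then have w: "w \<in> cball z1 \<rho>" "w \<in> B" using cbz by (auto simp: subset_iff)
    then show "G w \<le> G m" using m(2) by blast
    show "has_pd i G (g1 i w + \<eta> * \<psi>1 i w) w" unfolding G_def
      by (intro has_pd_add has_pd_cmult D1 P1 w)
  next
    show "has_pd i (\<lambda>x. g1 i x + \<eta> * \<psi>1 i x) (g2 i m + \<eta> * \<psi>2 i m) m"
      by (intro has_pd_add has_pd_cmult D2 P2) (use m(1) cbz in auto)
  qed
  then have "(\<Sum>i\<in>UNIV. g2 i m + \<eta> * \<psi>2 i m) \<le> 0" by (intro sum_nonpos) auto
  moreover have "(\<Sum>i\<in>UNIV. g2 i m + \<eta> * \<psi>2 i m) = \<eta> * (\<Sum>i\<in>UNIV. \<psi>2 i m)"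
    using lap m(1) cbz by (auto simp: sum.distrib sum_distrib_left)
  moreover have "\<eta> * (\<Sum>i\<in>UNIV. \<psi>2 i m) > 0" using \<eta> lap\<psi>[OF m(1)] by simp
  ultimately show False by linarith
qed

section \<open>The shear stress functions of the model solutions\<close>

text \<open>In the ratio \<open>q = r / R\<close> the equation \<open>fR n R r = 0\<close> reads \<open>ring_a n q = 1 / R\<^sup>2\<close>. The function
  \<open>ring_b\<close> is half the derivative of \<open>ring_a\<close>, both shear stresses satisfy
  \<open>\<tau>\<^sup>2 = (ring_b n q)\<^sup>2 / (ring_a n q - ring_a n 1)\<close>, and so \<open>\<tau>\<^sup>2 = T\<close> means \<open>ring_K n T q = 0\<close>.\<close>
definition ring_a :: "nat \<Rightarrow> real \<Rightarrow> real" where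
  "ring_a n q = q\<^sup>2 + 2 / ((real n - 2) * q ^ (n - 2))"

definition ring_b :: "nat \<Rightarrow> real \<Rightarrow> real" where
  "ring_b n q = q - 1 / q ^ (n - 1)"

definition ring_K :: "nat \<Rightarrow> real \<Rightarrow> real \<Rightarrow> real" where
  "ring_K n T q = (ring_b n q)\<^sup>2 - T * (ring_a n q - ring_a n 1)"

context
  fixes n :: nat
  assumes n: "n \<ge> 3"
begin

section \<open>Derivatives, signs and ranges of the ring functions\<close>

lemma ring_a_1: "ring_a n 1 = real n / (real n - 2)"
  using n by (simp add: ring_a_def field_simps)

lemma DERIV_one_over_power:
  fixes q :: real
  assumes "q > 0" shows "((\<lambda>q. 1 / q ^ k) has_real_derivative - real k / q ^ Suc k) (at q)"
proof -
  have "((\<lambda>q. inverse (q ^ k)) has_real_derivative - (real k * q ^ (k - 1) * inverse ((q ^ k) ^ 2))) (at q)"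
    using assms by (auto intro!: derivative_eq_intros simp: power2_eq_square)
  moreover have "- (real k * q ^ (k - 1) * inverse ((q ^ k) ^ 2)) = - real k / q ^ Suc k"
    using assms by (cases k) (simp_all add: power2_eq_square field_simps)
  ultimately show ?thesis by (simp only: inverse_eq_divide)
qed

lemma DERIV_ring_a:
  assumes "q > 0" shows "(ring_a n has_real_derivative 2 * ring_b n q) (at q)"
proof -
  have k: "Suc (n - 2) = n - 1" "real (n - 2) = real n - 2" using n by auto
  have eq: "ring_a n = (\<lambda>q. q\<^sup>2 + 2 / (real n - 2) * (1 / q ^ (n - 2)))"
    by (auto simp: ring_a_def)
  have "(ring_a n has_real_derivative 2 * q + 2 / (real n - 2) * (- real (n - 2) / q ^ Suc (n - 2))) (at q)"
    unfolding eq by (intro DERIV_add DERIV_cmult DERIV_one_over_power assms)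
      (auto intro!: derivative_eq_intros)
  moreover have "2 * q + 2 / (real n - 2) * (- real (n - 2) / q ^ Suc (n - 2)) = 2 * ring_b n q"
  proof -
    have "2 * q + 2 / D * (- D / X) = 2 * (q - 1 / X)" if "D \<noteq> 0" for D X :: real
      using that by (simp add: right_diff_distrib)
    from this[of "real n - 2" "q ^ (n - 1)"] show ?thesis unfolding k ring_b_def using n by simp
  qed
  ultimately show ?thesis by (simp only:)
qed

lemma DERIV_ring_b:
  assumes "q > 0" shows "(ring_b n has_real_derivative 1 + (real n - 1) / q ^ n) (at q)"
proof -
  have k: "Suc (n - 1) = n" "real (n - 1) = real n - 1" using n by auto
  have eq: "ring_b n = (\<lambda>q. q - 1 / q ^ (n - 1))" by (auto simp: ring_b_def)
  have "(ring_b n has_real_derivative 1 - (- real (n - 1) / q ^ Suc (n - 1))) (at q)"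
    unfolding eq by (intro DERIV_diff DERIV_ident DERIV_one_over_power assms)
  moreover have "1 - (- real (n - 1) / q ^ Suc (n - 1)) = 1 + (real n - 1) / q ^ n"
    unfolding k by (simp add: diff_divide_distrib)
  ultimately show ?thesis by (simp only:)
qed

lemma DERIV_ring_K:
  assumes "q > 0"
  shows "(ring_K n T has_real_derivative 2 * ring_b n q * (1 + (real n - 1) / q ^ n - T)) (at q)"
proof -
  have eq: "ring_K n T = (\<lambda>q. (ring_b n q)\<^sup>2 - T * (ring_a n q - ring_a n 1))"
    by (auto simp: ring_K_def)
  have "(ring_K n T has_real_derivative
      of_nat 2 * ((1 + (real n - 1) / q ^ n) * ring_b n q ^ (2 - Suc 0)) - T * (2 * ring_b n q - 0)) (at q)"
    unfolding eq
    by (intro DERIV_diff DERIV_cmult DERIV_power DERIV_const DERIV_ring_a DERIV_ring_b assms)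
  moreover have "of_nat 2 * ((1 + (real n - 1) / q ^ n) * ring_b n q ^ (2 - Suc 0)) - T * (2 * ring_b n q - 0)
      = 2 * ring_b n q * (1 + (real n - 1) / q ^ n - T)"
    by (simp add: algebra_simps)
  ultimately show ?thesis by (simp only:)
qed

lemma ring_b_pos: assumes "q > 1" shows "ring_b n q > 0"
proof -
  have "q ^ (n - 1) \<ge> 1" using assms by (simp add: one_le_power)
  then have "1 / q ^ (n - 1) \<le> 1" by simp
  then show ?thesis using assms unfolding ring_b_def by linarith
qed

lemma ring_b_neg: assumes "0 < q" "q < 1" shows "ring_b n q < 0"
proof -
  have "q ^ (n - 1) \<le> 1" using assms by (simp add: power_le_one)
  then have "1 \<le> 1 / q ^ (n - 1)" using assms by (simp add: le_divide_eq)
  then show ?thesis using assms unfolding ring_b_def by linarith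
qed

lemma ring_K_1: "ring_K n T 1 = 0"
  by (simp add: ring_K_def ring_b_def)

lemma ring_a_strict_mono:
  assumes "1 \<le> x" "x < y" shows "ring_a n x < ring_a n y"
proof -
  have "\<exists>z. x < z \<and> z < y \<and> ring_a n y - ring_a n x = (y - x) * (2 * ring_b n z)"
    by (rule MVT2) (use assms in \<open>auto intro!: DERIV_ring_a\<close>)
  then obtain z where "x < z" "z < y" "ring_a n y - ring_a n x = (y - x) * (2 * ring_b n z)" by blast
  moreover have "(y - x) * (2 * ring_b n z) > 0" using ring_b_pos[of z] assms calculation by (intro mult_pos_pos) auto
  ultimately show ?thesis by linarith
qed

lemma ring_a_strict_antimono:
  assumes "0 < x" "x < y" "y \<le> 1" shows "ring_a n y < ring_a n x"
proof -
  have "\<exists>z. x < z \<and> z < y \<and> ring_a n y - ring_a n x = (y - x) * (2 * ring_b n z)"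
    by (rule MVT2) (use assms in \<open>auto intro!: DERIV_ring_a\<close>)
  then obtain z where "x < z" "z < y" "ring_a n y - ring_a n x = (y - x) * (2 * ring_b n z)" by blast
  moreover have "(y - x) * (2 * ring_b n z) < 0" using ring_b_neg[of z] assms calculation by (intro mult_pos_neg) auto
  ultimately show ?thesis by linarith
qed

lemma ring_a_gt: "0 < q \<Longrightarrow> q \<noteq> 1 \<Longrightarrow> ring_a n 1 < ring_a n q"
  using ring_a_strict_mono[of 1 q] ring_a_strict_antimono[of q 1] by (cases "q < 1") auto

lemma ring_a_1_pos: "ring_a n 1 > 0"
  using n by (simp add: ring_a_1)

lemma ring_a_cont: "0 < x \<Longrightarrow> continuous_on {x..y} (ring_a n)"
  by (rule DERIV_continuous_on[where D = "\<lambda>q. 2 * ring_b n q"])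
     (auto intro!: has_field_derivative_at_within DERIV_ring_a)

lemma ring_K_cont: "0 < x \<Longrightarrow> continuous_on {x..y} (ring_K n T)"
  by (rule DERIV_continuous_on[where D = "\<lambda>q. 2 * ring_b n q * (1 + (real n - 1) / q ^ n - T)"])
     (auto intro!: has_field_derivative_at_within DERIV_ring_K)

lemma ring_a_surj_outer:
  assumes "ring_a n 1 < c" shows "\<exists>q>1. ring_a n q = c"
proof -
  define y where "y = c + 1"
  have c: "c > 0" using assms ring_a_1_pos by simp
  have "c \<le> y\<^sup>2" using c by (simp add: y_def power2_eq_square algebra_simps)
  also have "\<dots> \<le> ring_a n y" using n c by (simp add: ring_a_def y_def)
  finally have "\<exists>q\<ge>1. q \<le> y \<and> ring_a n q = c"
    using assms c by (intro IVT' ring_a_cont) (auto simp: y_def)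
  then obtain q where q: "1 \<le> q" "ring_a n q = c" by blast
  then have "q \<noteq> 1" using assms by auto
  then show ?thesis using q by (intro exI[of _ q]) auto
qed

lemma ring_a_surj_inner:
  assumes "ring_a n 1 < c" shows "\<exists>q. 0 < q \<and> q < 1 \<and> ring_a n q = c"
proof -
  \<comment> \<open>Chosen so that 2 / ((n - 2) y) = c + 2. As y < 1, replacing y by y^(n - 2) only
    enlarges the quotient, so \<open>ring_a n y\<close> exceeds c.\<close>
  define y where "y = 2 / ((real n - 2) * (c + 2))"
  have c: "c > 0" using assms ring_a_1_pos by simp
  have y0: "y > 0" using n c by (simp add: y_def)
  have "(real n - 2) * (c + 2) \<ge> 1 * (c + 2)" using n c by (intro mult_right_mono) auto
  moreover have "2 < 1 * (c + 2)" using c by simp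
  ultimately have "(real n - 2) * (c + 2) > 2" by (rule less_le_trans[rotated])
  then have y1: "y < 1" by (simp add: y_def divide_less_eq)
  have "y ^ (n - 2) \<le> y ^ 1" using y0 y1 n by (intro power_decreasing) auto
  then have "2 / ((real n - 2) * y) \<le> 2 / ((real n - 2) * y ^ (n - 2))"
    using n y0 by (intro divide_left_mono mult_left_mono mult_pos_pos) auto
  moreover have "2 / ((real n - 2) * y) = c + 2"
  proof -
    have "2 / (D * (2 / (D * (c + 2)))) = c + 2" if "D \<noteq> 0" for D :: real
      using that c by (simp add: field_simps)
    from this[of "real n - 2"] show ?thesis unfolding y_def using n by simp
  qed
  ultimately have "c \<le> ring_a n y" unfolding ring_a_def using zero_le_power2[of y] by linarith
  then have "\<exists>q\<ge>y. q \<le> 1 \<and> ring_a n q = c"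
    using assms y0 y1 by (intro IVT2' ring_a_cont) auto
  then obtain q where q: "y \<le> q" "q \<le> 1" "ring_a n q = c" by blast
  then have "q \<noteq> 1" using assms by auto
  then show ?thesis using q y0 by (intro exI[of _ q]) auto
qed

lemma ring_a_inj_outer: "1 < x \<Longrightarrow> 1 < y \<Longrightarrow> ring_a n x = ring_a n y \<Longrightarrow> x = y"
  using ring_a_strict_mono[of x y] ring_a_strict_mono[of y x] by (cases x y rule: linorder_cases) auto

lemma ring_a_inj_inner: "0 < x \<Longrightarrow> x < 1 \<Longrightarrow> 0 < y \<Longrightarrow> y < 1 \<Longrightarrow> ring_a n x = ring_a n y \<Longrightarrow> x = y"
  using ring_a_strict_antimono[of x y] ring_a_strict_antimono[of y x] by (cases x y rule: linorder_cases) auto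

text \<open>A zero of \<open>ring_K\<close> besides \<open>1\<close> forces, by Rolle, a zero of \<open>1 + (n - 1) / q ^ n - T\<close> in
  between; the latter is strictly monotone in \<open>q\<close>.\<close>
lemma ring_K_rolle:
  assumes "0 < x" "x < y" "y \<le> 1 \<or> 1 \<le> x" "ring_K n T x = ring_K n T y"
  shows "\<exists>z. x < z \<and> z < y \<and> 1 + (real n - 1) / z ^ n = T"
proof -
  have "\<exists>z. x < z \<and> z < y \<and> ring_K n T y - ring_K n T x = (y - x) * (2 * ring_b n z * (1 + (real n - 1) / z ^ n - T))"
    by (rule MVT2) (use assms in \<open>auto intro!: DERIV_ring_K\<close>)
  then obtain z where z: "x < z" "z < y" "(y - x) * (2 * ring_b n z * (1 + (real n - 1) / z ^ n - T)) = 0"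
    using assms(4) by auto
  have "ring_b n z \<noteq> 0" using ring_b_pos[of z] ring_b_neg[of z] z assms by force
  with z have "1 + (real n - 1) / z ^ n = T" using assms(2) by simp
  with z show ?thesis by blast
qed

lemma slope_strict_antimono:
  assumes "0 < x" "x < y" shows "1 + (real n - 1) / y ^ n < 1 + (real n - 1) / x ^ n"
proof -
  have "x ^ n < y ^ n" using n assms by (intro power_strict_mono) auto
  then have "(real n - 1) / y ^ n < (real n - 1) / x ^ n"
    using n assms by (intro divide_strict_left_mono) auto
  then show ?thesis by simp
qed

text \<open>The point 1 is always a zero. Two more zeros on the same side would leave two adjacent
  intervals between zeros, hence two different points at which the strictly monotone slope equals
  T.\<close>

lemma ring_K_zero_unique:
  assumes "0 < x" "0 < y" "(x < 1 \<and> y < 1) \<or> (1 < x \<and> 1 < y)" "ring_K n T x = 0" "ring_K n T y = 0"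
  shows "x = y"
proof -
  have F: False if lt: "x < y" and x: "0 < x" and s: "(x < 1 \<and> y < 1) \<or> (1 < x \<and> 1 < y)"
    and e: "ring_K n T x = 0" "ring_K n T y = 0" for x y
  proof -
    obtain z where z: "x < z" "z < y" "1 + (real n - 1) / z ^ n = T"
      using ring_K_rolle[of x y T] lt x s e by force
    show False
    proof (cases "x < 1")
      case True
      then have "y < 1" using s by auto
      then obtain z' where z': "y < z'" "z' < 1" "1 + (real n - 1) / z' ^ n = T"
        using ring_K_rolle[of y 1 T] lt x e ring_K_1 by force
      then show False using slope_strict_antimono[of z z'] z x by linarith
    next
      case False
      then have "1 < x" using s by auto
      then obtain z' where z': "1 < z'" "z' < x" "1 + (real n - 1) / z' ^ n = T"
        using ring_K_rolle[of 1 x T] e ring_K_1 by force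
      then show False using slope_strict_antimono[of z' z] z x by linarith
    qed
  qed
  show ?thesis
  proof (cases x y rule: linorder_cases)
    case less then show ?thesis using F[of x y] assms by blast
  next
    case greater then show ?thesis using F[of y x] assms by blast
  qed
qed

text \<open>The slope exceeds 1 everywhere, so Rolle's theorem rules out a second zero. This makes R
  = 0 the only preimage of 1 under \<open>tau2\<close>.\<close>

lemma ring_K_1_outer: assumes "q > 1" shows "ring_K n 1 q \<noteq> 0"
proof
  assume "ring_K n 1 q = 0"
  then obtain z where "z > 1" "1 + (real n - 1) / z ^ n = 1"
    using ring_K_rolle[of 1 q 1] assms ring_K_1 by force
  then show False using n by auto
qed

text \<open>The slope takes the value n only at 1, outside the open interval. This makes
  \<open>Rmax n\<close> the only preimage of sqrt n under \<open>tau1\<close>.\<close>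

lemma ring_K_n_inner: assumes "0 < q" "q < 1" shows "ring_K n (real n) q \<noteq> 0"
proof
  assume "ring_K n (real n) q = 0"
  then have "\<exists>z. q < z \<and> z < 1 \<and> 1 + (real n - 1) / z ^ n = real n"
    using assms ring_K_1[of "real n"] by (intro ring_K_rolle) auto
  then obtain z where "q < z" "z < 1" "1 + (real n - 1) / z ^ n = real n" by blast
  then show False using slope_strict_antimono[of z 1] assms by simp
qed

lemma slope_solution:
  assumes "1 < T" shows "\<exists>q>0. 1 + (real n - 1) / q ^ n = T"
proof -
  define q where "q = root n ((real n - 1) / (T - 1))"
  have pos: "(real n - 1) / (T - 1) > 0" "n > 0" using n assms by auto
  have "q > 0" unfolding q_def by (rule real_root_gt_zero[OF pos(2,1)])
  moreover have "q ^ n = (real n - 1) / (T - 1)" unfolding q_def by (rule real_root_pow_pos[OF pos(2,1)])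
  ultimately show ?thesis using n assms by (intro exI[of _ q]) simp
qed

text \<open>From its zero at 1 the function increases up to the point s where the slope equals T,
  and for large q it behaves like (1 - T) q^2; a sign change lies in between.\<close>

lemma ring_K_zero_outer:
  assumes T: "1 < T" "T < real n" shows "\<exists>q>1. ring_K n T q = 0"
proof -
  obtain s where s: "s > 0" "1 + (real n - 1) / s ^ n = T" using slope_solution T by blast
  have s1: "s > 1"
  proof (rule ccontr)
    assume "\<not> s > 1"
    then have "s < 1 \<or> s = 1" by auto
    then show False using slope_strict_antimono[of s 1] s T by auto
  qed
  have "\<exists>z. 1 < z \<and> z < s \<and> ring_K n T s - ring_K n T 1 = (s - 1) * (2 * ring_b n z * (1 + (real n - 1) / z ^ n - T))"
    by (rule MVT2) (use s1 in \<open>auto intro!: DERIV_ring_K\<close>)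
  then obtain z where z: "1 < z" "z < s" "ring_K n T s = (s - 1) * (2 * ring_b n z * (1 + (real n - 1) / z ^ n - T))"
    using ring_K_1 by auto
  then have pos: "ring_K n T s > 0"
    using slope_strict_antimono[of z s] s s1 ring_b_pos[of z] by simp
  \<comment> \<open>Large enough that T * \<open>ring_a n 1\<close> \<le> (T - 1) y \<le> (T - 1)
    y^2.\<close>
  define y where "y = s + T * ring_a n 1 / (T - 1)"
  have y: "y \<ge> s" "y \<ge> T * ring_a n 1 / (T - 1)" "y \<ge> 1"
  proof -
    have "T * ring_a n 1 / (T - 1) \<ge> 0" using T ring_a_1_pos by simp
    then show "y \<ge> s" "y \<ge> T * ring_a n 1 / (T - 1)" "y \<ge> 1" using s1 by (auto simp: y_def)
  qed
  have "0 \<le> ring_b n y" "ring_b n y \<le> y" using ring_b_pos[of y] y s1 by (auto simp: ring_b_def)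
  then have "(ring_b n y)\<^sup>2 \<le> y\<^sup>2" by (intro power_mono)
  moreover have "y\<^sup>2 \<le> ring_a n y" using n y by (simp add: ring_a_def)
  then have "T * y\<^sup>2 \<le> T * ring_a n y" using T by simp
  moreover have "T * ring_a n 1 \<le> (T - 1) * y" using y T by (simp add: field_simps)
  moreover have "(T - 1) * y \<le> (T - 1) * y\<^sup>2" using T y by (intro mult_left_mono) (auto simp: power2_eq_square)
  ultimately have "ring_K n T y \<le> 0" by (simp add: ring_K_def algebra_simps)
  then have "\<exists>q\<ge>s. q \<le> y \<and> ring_K n T q = 0"
    using pos y s1 by (intro IVT2' ring_K_cont) auto
  then show ?thesis using s1 less_le_trans by blast
qed

text \<open>The function increases from s to its zero at 1, so it is negative at s. Near 0 it is
  positive, because the square of \<open>ring_b\<close> grows like q^(2 - 2 n) and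
  \<open>ring_a\<close> only like q^(2 - n).\<close>

lemma ring_K_zero_inner:
  assumes T: "real n < T" shows "\<exists>q. 0 < q \<and> q < 1 \<and> ring_K n T q = 0"
proof -
  have "T > 1" using T n by simp
  then obtain s where s: "s > 0" "1 + (real n - 1) / s ^ n = T" using slope_solution by blast
  have s1: "s < 1"
  proof (rule ccontr)
    assume "\<not> s < 1"
    then have "s > 1 \<or> s = 1" by auto
    then show False using slope_strict_antimono[of 1 s] s T by auto
  qed
  have "\<exists>z. s < z \<and> z < 1 \<and> ring_K n T 1 - ring_K n T s = (1 - s) * (2 * ring_b n z * (1 + (real n - 1) / z ^ n - T))"
    by (rule MVT2) (use s1 s in \<open>auto intro!: DERIV_ring_K\<close>)
  then obtain z where z: "s < z" "z < 1" "- ring_K n T s = (1 - s) * (2 * ring_b n z * (1 + (real n - 1) / z ^ n - T))"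
    using ring_K_1 by auto
  have "ring_b n z * (1 + (real n - 1) / z ^ n - T) > 0"
    using slope_strict_antimono[of s z] s s1 ring_b_neg[of z] z by (intro mult_neg_neg) auto
  then have "(1 - s) * (2 * ring_b n z * (1 + (real n - 1) / z ^ n - T)) > 0"
    using s1 by simp
  then have neg: "ring_K n T s < 0" using z by linarith
  \<comment> \<open>With w = 1 / y^n one has \<open>ring_b n y\<close> = y (1 - w) and
    \<open>ring_a n y\<close> \<le> y^2 (1 + 2 w). So T (1 + 2 w) \<le> (1 - w)^2 suffices, and w
    \<ge> 2 T + 4 ensures it.\<close>
  define y where "y = min s (1 / (2 * T + 4))"
  have y: "0 < y" "y \<le> s" "y \<le> 1 / (2 * T + 4)" using s \<open>T > 1\<close> by (auto simp: y_def)
  define w where "w = 1 / y ^ n"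
  have "y ^ n \<le> y ^ 1" using y s1 n by (intro power_decreasing) auto
  then have "1 / y \<le> w" using y by (simp add: w_def divide_left_mono)
  moreover have "2 * T + 4 \<le> 1 / y" using y \<open>T > 1\<close> by (simp add: field_simps)
  ultimately have w: "2 * T + 4 \<le> w" by linarith
  have b: "ring_b n y = y * (1 - w)"
  proof -
    have "y ^ n = y * y ^ (n - 1)" using n by (simp flip: power_Suc)
    then show ?thesis using y by (simp add: ring_b_def w_def field_simps)
  qed
  have a: "ring_a n y \<le> y\<^sup>2 * (1 + 2 * w)"
  proof -
    have "n = 2 + (n - 2)" using n by simp
    then have "y ^ n = y\<^sup>2 * y ^ (n - 2)" by (metis power_add)
    then have "y\<^sup>2 * w = 1 / y ^ (n - 2)" using y by (simp add: w_def)
    moreover have "1 * y ^ (n - 2) \<le> (real n - 2) * y ^ (n - 2)" using n y by (intro mult_right_mono) auto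
    then have "2 / ((real n - 2) * y ^ (n - 2)) \<le> 2 / y ^ (n - 2)" using n y by (intro divide_left_mono mult_pos_pos) auto
    ultimately show ?thesis by (simp add: ring_a_def algebra_simps)
  qed
  have "T * (1 + 2 * w) \<le> (1 - w)\<^sup>2"
  proof -
    have "(2 * T + 4) * w \<le> w * w" using w \<open>T > 1\<close> by (intro mult_right_mono) auto
    then show ?thesis using w \<open>T > 1\<close> by (simp add: power2_eq_square algebra_simps)
  qed
  then have "y\<^sup>2 * (T * (1 + 2 * w)) \<le> y\<^sup>2 * (1 - w)\<^sup>2" by (intro mult_left_mono) auto
  moreover have "T * ring_a n y \<le> T * (y\<^sup>2 * (1 + 2 * w))" using a \<open>T > 1\<close> by (intro mult_left_mono) auto
  moreover have "T * ring_a n 1 \<ge> 0" using ring_a_1_pos \<open>T > 1\<close> by simp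
  moreover have "y\<^sup>2 * (T * (1 + 2 * w)) = T * (y\<^sup>2 * (1 + 2 * w))" by simp
  moreover have "ring_K n T y = y\<^sup>2 * (1 - w)\<^sup>2 - T * ring_a n y + T * ring_a n 1"
    unfolding ring_K_def b power_mult_distrib by (simp only: right_diff_distrib)
  ultimately have "ring_K n T y \<ge> 0" by linarith
  then have "\<exists>q\<ge>y. q \<le> s \<and> ring_K n T q = 0"
    using neg y s1 by (intro IVT2' ring_K_cont) auto
  then show ?thesis using s1 y by (meson le_less_trans less_le_trans)
qed

section \<open>The model radii and shear stresses in terms of the ratio\<close>

text \<open>Both r^2 and R^n / r^(n - 2) are homogeneous of degree two in (r, R), so
  \<open>fR n R (R * q)\<close> is 1 - R^2 * \<open>ring_a n q\<close>.\<close>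

lemma fR_zero_iff:
  assumes "R > 0" "q > 0" shows "fR n R (R * q) = 0 \<longleftrightarrow> ring_a n q = 1 / R\<^sup>2"
proof -
  have "n = 2 + (n - 2)" using n by simp
    then have "R ^ n = R\<^sup>2 * R ^ (n - 2)" by (metis power_add)
  moreover have "2 * (S * X) / (D * (X * Y)) = S * (2 / (D * Y))" if "X \<noteq> 0" for S X D Y :: real
    using that by simp
  ultimately have "2 * R ^ n / ((real n - 2) * (R * q) ^ (n - 2)) = R\<^sup>2 * (2 / ((real n - 2) * q ^ (n - 2)))"
    using assms by (simp only: power_mult_distrib) simp
  then have "fR n R (R * q) = 1 - R\<^sup>2 * ring_a n q"
    unfolding fR_def ring_a_def by (simp only: power_mult_distrib right_diff_distrib distrib_left)
  then show ?thesis using assms by (auto simp: eq_divide_eq mult.commute)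
qed

text \<open>\<open>ring_a n 1\<close> is the minimum of \<open>ring_a\<close> on the positive axis
  and equals 1 / \<open>Rmax\<close>^2. Below \<open>Rmax\<close> the equation for q therefore has a
  root on each side of 1.\<close>

lemma Rmax_iff: "R > 0 \<Longrightarrow> R < Rmax n \<longleftrightarrow> ring_a n 1 < 1 / R\<^sup>2"
proof -
  assume R: "R > 0"
  have "R < Rmax n \<longleftrightarrow> R\<^sup>2 < (real n - 2) / real n"
    unfolding Rmax_def using R n by (metis abs_of_pos real_sqrt_abs real_sqrt_less_iff)
  also have "\<dots> \<longleftrightarrow> ring_a n 1 < 1 / R\<^sup>2" using n R by (simp add: ring_a_1 field_simps)
  finally show ?thesis .
qed

lemma r2_eq:
  assumes "R > 0" "q > 1" "ring_a n q = 1 / R\<^sup>2" shows "r2 n R = R * q"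
  unfolding r2_def
proof (rule the_equality)
  show "R < R * q \<and> 0 < R * q \<and> fR n R (R * q) = 0" using assms fR_zero_iff by simp
  fix r assume r: "R < r \<and> 0 < r \<and> fR n R r = 0"
  then have "ring_a n (r / R) = 1 / R\<^sup>2" using fR_zero_iff[of R "r / R"] assms by simp
  then have "r / R = q" using r assms by (auto intro: ring_a_inj_outer[of "r / R" q])
  then show "r = R * q" using assms by auto
qed

lemma r1_eq:
  assumes "R > 0" "0 < q" "q < 1" "ring_a n q = 1 / R\<^sup>2" shows "r1 n R = R * q"
  unfolding r1_def
proof (rule the_equality)
  show "0 < R * q \<and> R * q < R \<and> fR n R (R * q) = 0" using assms fR_zero_iff by simp
  fix r assume r: "0 < r \<and> r < R \<and> fR n R r = 0"
  then have "ring_a n (r / R) = 1 / R\<^sup>2" using fR_zero_iff[of R "r / R"] assms by simp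
  then have "r / R = q" using r assms by (auto intro: ring_a_inj_inner[of "r / R" q])
  then show "r = R * q" using assms by auto
qed

text \<open>The factor R cancels against the one in r = R q, so the shear stress depends on q
  alone.\<close>

lemma sqrt_denominator:
  assumes "R > 0" "ring_a n q = 1 / R\<^sup>2"
  shows "sqrt (1 - real n * R\<^sup>2 / (real n - 2)) = R * sqrt (ring_a n q - ring_a n 1)"
proof -
  have "1 - real n * R\<^sup>2 / (real n - 2) = R\<^sup>2 * (ring_a n q - ring_a n 1)"
    using assms n by (simp add: ring_a_1 field_simps)
  then show ?thesis using assms by (simp add: real_sqrt_mult)
qed

lemma ring_b_alt: "q > 0 \<Longrightarrow> q * (1 - 1 / q ^ n) = ring_b n q"
proof -
  assume q: "q > 0"
  have "q ^ n = q * q ^ (n - 1)" using n by (simp flip: power_Suc)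
  then show ?thesis using q by (simp add: ring_b_def field_simps)
qed

lemma tau2_eq:
  assumes R: "R > 0" "q > 1" "ring_a n q = 1 / R\<^sup>2"
  shows "tau2 n R = ring_b n q / sqrt (ring_a n q - ring_a n 1)"
proof -
  have "R ^ n / (R * q) ^ n = 1 / q ^ n" using R by (simp add: power_mult_distrib)
  then show ?thesis
    using R ring_b_alt[of q] unfolding tau2_def r2_eq[OF R] sqrt_denominator[OF R(1,3)]
    by (simp add: mult.assoc)
qed

lemma tau1_eq:
  assumes R: "R > 0" "0 < q" "q < 1" "ring_a n q = 1 / R\<^sup>2"
  shows "tau1 n R = - ring_b n q / sqrt (ring_a n q - ring_a n 1)"
proof -
  have "R \<noteq> Rmax n" using Rmax_iff[OF R(1)] ring_a_gt[of q] R by simp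
  moreover have "R ^ n / (R * q) ^ n = 1 / q ^ n" using R by (simp add: power_mult_distrib)
  moreover have "q * (1 / q ^ n - 1) = - ring_b n q" using ring_b_alt[of q] R by (simp add: algebra_simps)
  ultimately show ?thesis
    using R unfolding tau1_def r1_eq[OF R] sqrt_denominator[OF R(1,4)]
    by (simp add: mult.assoc)
qed

lemma quotient_eq_iff_ring_K:
  assumes "t > 0" "x > 0" "x\<^sup>2 = (ring_b n q)\<^sup>2" "0 < q" "q \<noteq> 1"
  shows "x / sqrt (ring_a n q - ring_a n 1) = t \<longleftrightarrow> ring_K n (t\<^sup>2) q = 0"
proof -
  let ?A = "ring_a n q - ring_a n 1"
  have A: "?A > 0" using ring_a_gt assms by simp
  have "x / sqrt ?A = t \<longleftrightarrow> x = t * sqrt ?A" using A by (simp add: divide_eq_eq)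
  also have "\<dots> \<longleftrightarrow> x\<^sup>2 = (t * sqrt ?A)\<^sup>2" using assms A by (subst power2_eq_iff_nonneg) auto
  also have "\<dots> \<longleftrightarrow> ring_K n (t\<^sup>2) q = 0" using A assms(3) by (simp add: power_mult_distrib ring_K_def)
  finally show ?thesis .
qed

lemma radius_of_ratio:
  assumes "0 < q" "q \<noteq> 1"
  obtains R where "R > 0" "R < Rmax n" "ring_a n q = 1 / R\<^sup>2"
proof -
  have a: "ring_a n q > ring_a n 1" "ring_a n q > 0" using ring_a_gt[OF assms] ring_a_1_pos by auto
  define R where "R = 1 / sqrt (ring_a n q)"
  have R: "R > 0" "ring_a n q = 1 / R\<^sup>2" using a by (auto simp: R_def power_divide)
  then have "R < Rmax n" using a(1) Rmax_iff[OF R(1)] by metis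
  then show ?thesis using that R by blast
qed

lemma Rmax_pos: "Rmax n > 0"
  using n by (simp add: Rmax_def)

section \<open>Inverting the shear stress functions\<close>

text \<open>For t > 1 a preimage R corresponds to a zero q > 1 of
  \<open>ring_K n (t\<^sup>2)\<close>, of which there is exactly one. The value t = 1 belongs to the
  separate clause R = 0.\<close>

lemma tau2_ex1:
  assumes t: "1 \<le> t" "t < sqrt (real n)"
  shows "\<exists>!R. 0 \<le> R \<and> R < Rmax n \<and> tau2 n R = t"
proof -
  have uniq: "\<exists>q>1. ring_a n q = 1 / R\<^sup>2 \<and> ring_K n (t\<^sup>2) q = 0" if R: "0 < R" "R < Rmax n" "tau2 n R = t" for R
  proof -
    obtain q where q: "q > 1" "ring_a n q = 1 / R\<^sup>2"
      using ring_a_surj_outer[of "1 / R\<^sup>2"] Rmax_iff[OF R(1)] R(2) by blast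
    then show ?thesis using tau2_eq[OF R(1) q] R(3) quotient_eq_iff_ring_K[of t "ring_b n q" q] ring_b_pos[of q] t
      by auto
  qed
  show ?thesis
  proof (cases "t = 1")
    case True
    show ?thesis
    proof (rule ex1I[of _ 0])
      show "0 \<le> (0::real) \<and> 0 < Rmax n \<and> tau2 n 0 = t" using True Rmax_pos by (simp add: tau2_def)
      fix R assume R: "0 \<le> R \<and> R < Rmax n \<and> tau2 n R = t"
      show "R = 0"
      proof (rule ccontr)
        assume "R \<noteq> 0"
        then show False using uniq[of R] R ring_K_1_outer True by auto
      qed
    qed
  next
    case False
    then have t1: "t > 1" using t by simp
    have "t\<^sup>2 < real n" using t by (metis abs_of_nonneg less_eq_real_def order_trans real_sqrt_abs real_sqrt_less_iff zero_le_one)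
    moreover have "1 < t\<^sup>2" using t1 by (simp add: one_less_power)
    ultimately obtain q where q: "q > 1" "ring_K n (t\<^sup>2) q = 0" using ring_K_zero_outer by blast
    then obtain R where R: "R > 0" "R < Rmax n" "ring_a n q = 1 / R\<^sup>2" using radius_of_ratio[of q] by auto
    show ?thesis
    proof (rule ex1I[of _ R])
      show "0 \<le> R \<and> R < Rmax n \<and> tau2 n R = t"
        using R q tau2_eq[OF R(1) q(1) R(3)] quotient_eq_iff_ring_K[of t "ring_b n q" q] ring_b_pos[of q] t by auto
      fix R' assume R': "0 \<le> R' \<and> R' < Rmax n \<and> tau2 n R' = t"
      then have "R' \<noteq> 0" using False by (auto simp: tau2_def)
      then obtain q' where "q' > 1" "ring_a n q' = 1 / R'\<^sup>2" "ring_K n (t\<^sup>2) q' = 0" using uniq[of R'] R' by auto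
      moreover from this have "q' = q" using ring_K_zero_unique[of q' q] q by auto
      ultimately have "R'\<^sup>2 = R\<^sup>2" using R by auto
      then show "R' = R" using R R' by auto
    qed
  qed
qed

lemma tau1_ex1:
  assumes t: "sqrt (real n) \<le> t"
  shows "\<exists>!R. 0 < R \<and> R \<le> Rmax n \<and> tau1 n R = t"
proof -
  have "sqrt (real n) > 0" using n by simp
  then have t0: "t > 0" using t by linarith
  have uniq: "\<exists>q. 0 < q \<and> q < 1 \<and> ring_a n q = 1 / R\<^sup>2 \<and> ring_K n (t\<^sup>2) q = 0"
    if R: "0 < R" "R < Rmax n" "tau1 n R = t" for R
  proof -
    obtain q where q: "0 < q" "q < 1" "ring_a n q = 1 / R\<^sup>2"
      using ring_a_surj_inner[of "1 / R\<^sup>2"] Rmax_iff[OF R(1)] R(2) by blast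
    then show ?thesis using tau1_eq[OF R(1) q] R(3) quotient_eq_iff_ring_K[of t "- ring_b n q" q] ring_b_neg[of q] t0
      by auto
  qed
  show ?thesis
  \<comment> \<open>At \<open>Rmax n\<close> the two roots merge at q = 1 and the quotient
    degenerates; \<open>tau1\<close> has its own clause there.\<close>
  proof (cases "t = sqrt (real n)")
    case True
    show ?thesis
    proof (rule ex1I[of _ "Rmax n"])
      show "0 < Rmax n \<and> Rmax n \<le> Rmax n \<and> tau1 n (Rmax n) = t" using True Rmax_pos by (simp add: tau1_def)
      fix R assume R: "0 < R \<and> R \<le> Rmax n \<and> tau1 n R = t"
      show "R = Rmax n"
      proof (rule ccontr)
        assume "R \<noteq> Rmax n"
        then show False using uniq[of R] R ring_K_n_inner True by auto
      qed
    qed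
  next
    case False
    then have "sqrt (real n) < t" using t by simp
    then have "(sqrt (real n))\<^sup>2 < t\<^sup>2" by (intro power_strict_mono) auto
    then have "real n < t\<^sup>2" by simp
    then obtain q where q: "0 < q" "q < 1" "ring_K n (t\<^sup>2) q = 0" using ring_K_zero_inner by blast
    then obtain R where R: "R > 0" "R < Rmax n" "ring_a n q = 1 / R\<^sup>2" using radius_of_ratio[of q] by auto
    show ?thesis
    proof (rule ex1I[of _ R])
      show "0 < R \<and> R \<le> Rmax n \<and> tau1 n R = t"
        using R q tau1_eq[OF R(1) q(1,2) R(3)] quotient_eq_iff_ring_K[of t "- ring_b n q" q] ring_b_neg[of q] t0 by auto
      fix R' assume R': "0 < R' \<and> R' \<le> Rmax n \<and> tau1 n R' = t"
      then have "R' \<noteq> Rmax n" using False by (auto simp: tau1_def)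
      then obtain q' where "0 < q'" "q' < 1" "ring_a n q' = 1 / R'\<^sup>2" "ring_K n (t\<^sup>2) q' = 0" using uniq[of R'] R' by auto
      moreover from this have "q' = q" using ring_K_zero_unique[of q' q] q by auto
      ultimately have "R'\<^sup>2 = R\<^sup>2" using R by auto
      then show "R' = R" using R R' by auto
    qed
  qed
qed

text \<open>Radius 0 occurs only in the \<open>tau2\<close> branch, where
  \<open>tau2 n 0 = 1\<close>. The \<open>tau1\<close> branch has positive radii and t \<ge> sqrt n
  > 1.\<close>

lemma core_radius_nonneg_and_zero_iff:
  assumes t: "1 \<le> t"
  shows "core_radius n t \<ge> 0 \<and> (core_radius n t = 0 \<longleftrightarrow> t = 1)"
proof (cases "t < sqrt (real n)")
  case True
  have c: "core_radius n t = (THE R. 0 \<le> R \<and> R < Rmax n \<and> tau2 n R = t)"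
    using True by (simp add: core_radius_def)
  have p: "0 \<le> core_radius n t \<and> core_radius n t < Rmax n \<and> tau2 n (core_radius n t) = t"
    unfolding c by (rule theI'[OF tau2_ex1[OF t True]])
  have "core_radius n t = 0" if "t = 1"
    unfolding c using Rmax_pos that
    by (intro the1_equality[OF tau2_ex1[OF t True]]) (simp add: tau2_def)
  then show ?thesis using p by (auto simp: tau2_def)
next
  case False
  have c: "core_radius n t = (THE R. 0 < R \<and> R \<le> Rmax n \<and> tau1 n R = t)"
    using False by (simp add: core_radius_def)
  have p: "0 < core_radius n t \<and> core_radius n t \<le> Rmax n \<and> tau1 n (core_radius n t) = t"
    unfolding c by (rule theI'[OF tau1_ex1]) (use False in simp)
  have "sqrt (real n) > 1" using n by simp
  then show ?thesis using p False by auto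
qed

end

section \<open>Rigidity of torsion solutions\<close>

text \<open>One use of l'Hospital's rule reduces the quotient to - \<open>\<phi>1 t / t\<close>,
  whose limit is the derivative of \<open>\<phi>1\<close> at 0.\<close>

lemma second_order_quotient_at_right:
  fixes \<phi> :: "real \<Rightarrow> real"
  assumes d: "d > 0" and D1: "\<And>s. \<bar>s\<bar> < d \<Longrightarrow> (\<phi> has_real_derivative \<phi>1 s) (at s)"
    and D2: "(\<phi>1 has_real_derivative c) (at 0)" and z: "\<phi>1 0 = 0"
  shows "((\<lambda>t. 2 * (\<phi> 0 - \<phi> t) / t\<^sup>2) \<longlongrightarrow> - c) (at_right 0)"
proof (rule lhopital_right_0[where f' = "\<lambda>t. - 2 * \<phi>1 t" and g' = "\<lambda>t. 2 * t"])
  have "isCont \<phi> 0" using D1[of 0] d DERIV_isCont by auto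
  then have "(\<phi> \<longlongrightarrow> \<phi> 0) (at_right 0)"
    unfolding isCont_def by (rule tendsto_mono[rotated]) (simp add: at_le)
  then have "((\<lambda>t. 2 * (\<phi> 0 - \<phi> t)) \<longlongrightarrow> 2 * (\<phi> 0 - \<phi> 0)) (at_right 0)"
    by (intro tendsto_intros)
  then show "((\<lambda>t. 2 * (\<phi> 0 - \<phi> t)) \<longlongrightarrow> 0) (at_right 0)" by simp
  have "((\<lambda>t::real. t\<^sup>2) \<longlongrightarrow> 0\<^sup>2) (at_right 0)" by (intro tendsto_intros)
  then show "((\<lambda>t::real. t\<^sup>2) \<longlongrightarrow> 0) (at_right 0)" by simp
  show "\<forall>\<^sub>F x::real in at_right 0. x\<^sup>2 \<noteq> 0" "\<forall>\<^sub>F x::real in at_right 0. 2 * x \<noteq> 0"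
    by (auto simp: eventually_at_filter)
  show "\<forall>\<^sub>F x in at_right 0. ((\<lambda>t. 2 * (\<phi> 0 - \<phi> t)) has_real_derivative - 2 * \<phi>1 x) (at x)"
    using eventually_at_right_less[of 0] eventually_at_right_real[OF d]
    by eventually_elim (auto intro!: derivative_eq_intros D1)
  show "\<forall>\<^sub>F x::real in at_right 0. (power2 has_real_derivative 2 * x) (at x)"
    by (intro always_eventually allI) (auto intro!: derivative_eq_intros)
  have "((\<lambda>t. \<phi>1 t / t) \<longlongrightarrow> c) (at 0)"
    using D2 z by (simp add: has_field_derivative_iff)
  then have "((\<lambda>t. \<phi>1 t / t) \<longlongrightarrow> c) (at_right 0)"
    by (rule tendsto_mono[rotated]) (simp add: at_le)
  then have "((\<lambda>t. - (\<phi>1 t / t)) \<longlongrightarrow> - c) (at_right 0)" by (intro tendsto_intros)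
  then show "((\<lambda>t. - 2 * \<phi>1 t / (2 * t)) \<longlongrightarrow> - c) (at_right 0)" by simp
qed

lemma norm_vec_power2: "(norm (x :: real^'n::finite))\<^sup>2 = (\<Sum>i\<in>UNIV. (x $ i)\<^sup>2)"
  unfolding power2_norm_eq_inner by (simp add: inner_vec_def power2_eq_square)

section \<open>Positivity, maximum and boundary gradient of a torsion solution\<close>

locale torsion =
  fixes \<Omega> :: "(real^'n::finite) set" and u :: "real^'n \<Rightarrow> real"
  assumes opn: "open \<Omega>" and con: "connected \<Omega>" and bdd: "bounded \<Omega>" and nonempty: "\<Omega> \<noteq> {}"
    and sol: "torsion_solution \<Omega> u"
begin

lemma diff_u: "x \<in> \<Omega> \<Longrightarrow> u differentiable (at x)"
  and diff_partial: "x \<in> \<Omega> \<Longrightarrow> partial i u differentiable (at x)"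
  and cont_second: "continuous_on \<Omega> (partial i (partial i u))"
  and cont_u: "continuous_on (closure \<Omega>) u"
  and u_frontier: "x \<in> frontier \<Omega> \<Longrightarrow> u x = 0"
  and laplace: "x \<in> \<Omega> \<Longrightarrow> (\<Sum>i\<in>UNIV. partial i (partial i u) x) = - real CARD('n)"
  using sol by (auto simp: torsion_solution_def laplacian_def)

lemma cont_u': "continuous_on \<Omega> u"
  using cont_u closure_subset continuous_on_subset by blast

lemma cont_partial: "continuous_on \<Omega> (partial i u)"
  by (meson continuous_at_imp_continuous_on differentiable_imp_continuous_within diff_partial)

lemma pd1: "x \<in> \<Omega> \<Longrightarrow> has_pd i u (partial i u x) x"
  by (rule has_pd_partial[OF diff_u])

lemma pd2: "x \<in> \<Omega> \<Longrightarrow> has_pd i (partial i u) (partial i (partial i u) x) x"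
  by (rule has_pd_partial[OF diff_partial])

lemma u_along:
  assumes "p + s *\<^sub>R v \<in> \<Omega>"
  shows "((\<lambda>s. u (p + s *\<^sub>R v)) has_real_derivative (\<Sum>i\<in>UNIV. v $ i * partial i u (p + s *\<^sub>R v))) (at s)"
  using differentiable_has_derivative_along[OF diff_u[OF assms]]
  by (simp add: frechet_derivative_eq_sum_partial[OF diff_u[OF assms]])

lemma compact_closure_domain: "compact (closure \<Omega>)"
  using bounded_closure[OF bdd] by (simp add: compact_eq_bounded_closed)

lemma closure_nonempty: "closure \<Omega> \<noteq> {}"
  using nonempty by simp

text \<open>At an interior minimum all pure second derivatives would be nonnegative, against the
  Laplacian - n. So the minimum over the closure lies only on the frontier, where u = 0.\<close>

lemma u_pos:
  assumes "x \<in> \<Omega>" shows "u x > 0"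
proof -
  obtain m where m: "m \<in> closure \<Omega>" "\<And>y. y \<in> closure \<Omega> \<Longrightarrow> u m \<le> u y"
    using continuous_attains_inf[OF compact_closure_domain closure_nonempty cont_u] by blast
  have not_min: "\<exists>y\<in>\<Omega>. u y < u w" if w: "w \<in> \<Omega>" for w
  proof (rule ccontr)
    assume no: "\<not> (\<exists>y\<in>\<Omega>. u y < u w)"
    have "- partial i (partial i u) w \<le> 0" for i
      by (rule has_pd_second_nonpos_at_max[OF opn w, of i "\<lambda>x. - u x" "\<lambda>x. - partial i u x"])
         (use no w in \<open>auto intro!: has_pd_minus pd1 pd2 simp: not_less\<close>)
    then have "(\<Sum>i\<in>UNIV. partial i (partial i u) w) \<ge> 0" by (intro sum_nonneg) simp
    then show False using laplace[OF w] by simp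
  qed
  have mle: "u m \<le> u y" if "y \<in> \<Omega>" for y using m(2) that closure_subset by blast
  have "m \<notin> \<Omega>" using not_min[of m] mle not_less by blast
  then have "u m = 0" using m(1) opn by (intro u_frontier) (simp add: frontier_def interior_open)
  moreover have "u m < u x" using not_min[OF assms] mle by force
  ultimately show ?thesis by simp
qed

lemma max_attained: "\<exists>m\<in>\<Omega>. u m = umax \<Omega> u"
  and u_le_max: "x \<in> \<Omega> \<Longrightarrow> u x \<le> umax \<Omega> u"
proof -
  obtain m where m: "m \<in> closure \<Omega>" "\<And>y. y \<in> closure \<Omega> \<Longrightarrow> u y \<le> u m"
    using continuous_attains_sup[OF compact_closure_domain closure_nonempty cont_u] by blast
  obtain x0 where x0: "x0 \<in> \<Omega>" using nonempty by blast
  have "u m > 0" using m(2)[of x0] u_pos[OF x0] x0 closure_subset by fastforce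
  then have "m \<in> \<Omega>" using m(1) u_frontier[of m] opn by (auto simp: frontier_def interior_open)
  moreover have "umax \<Omega> u = u m" unfolding umax_def
    by (rule cSup_eq_maximum) (use \<open>m \<in> \<Omega>\<close> m(2) closure_subset in auto)
  ultimately show "\<exists>m\<in>\<Omega>. u m = umax \<Omega> u" "x \<in> \<Omega> \<Longrightarrow> u x \<le> umax \<Omega> u"
    using m(2) closure_subset by auto
qed

lemma umax_pos: "umax \<Omega> u > 0"
  using max_attained u_pos by force

lemma open_nonmax: "open (\<Omega> - MAXset \<Omega> u)"
proof -
  have "\<Omega> - MAXset \<Omega> u = \<Omega> \<inter> u -` (- {umax \<Omega> u})" by (auto simp: MAXset_def)
  then show ?thesis using continuous_open_preimage[OF cont_u' opn, of "- {umax \<Omega> u}"] by (simp add: open_Compl)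
qed

lemma partial_zero_at_max:
  assumes "p \<in> MAXset \<Omega> u" shows "partial i u p = 0"
proof -
  have p: "p \<in> \<Omega>" "u p = umax \<Omega> u" using assms by (auto simp: MAXset_def)
  obtain d where d: "d > 0" "ball p d \<subseteq> \<Omega>" using opn p(1) openE by blast
  have le: "u (p + s *\<^sub>R axis i 1) \<le> u p" if "\<bar>s\<bar> < d" for s
  proof -
    have "p + s *\<^sub>R axis i 1 \<in> ball p d" using that by (simp add: dist_norm)
    then show ?thesis using d u_le_max p(2) by auto
  qed
  show ?thesis
    by (rule DERIV_local_max[of "\<lambda>s. u (p + s *\<^sub>R axis i 1)" _ 0 d])
       (use d le pd1[OF p(1), of i] in \<open>auto simp: has_pd_def\<close>)
qed

text \<open>A frontier point of the open set \<Omega> is a limit point of it, so the limit in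
  \<open>bgrad\<close> is unique and is the value of the continuous extension. Boundary gradients
  thus become values of one continuous function.\<close>

lemma gradient_extension:
  obtains G where "continuous_on (closure \<Omega>) G" "\<And>x. x \<in> \<Omega> \<Longrightarrow> G x = grad u x"
    "\<And>x. x \<in> frontier \<Omega> \<Longrightarrow> bgrad \<Omega> u x = G x"
proof -
  obtain G where G: "continuous_on (closure \<Omega>) G" "\<And>x. x \<in> \<Omega> \<Longrightarrow> G x = grad u x"
    using sol by (auto simp: torsion_solution_def)
  have "bgrad \<Omega> u x = G x" if "x \<in> frontier \<Omega>" for x
    unfolding bgrad_def
  proof (rule tendsto_Lim)
    have x: "x \<in> closure \<Omega>" "x \<notin> \<Omega>" using that opn by (auto simp: frontier_def interior_open)
    then have "x islimpt \<Omega>" by (simp add: closure_def)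
    then show "\<not> trivial_limit (at x within \<Omega>)" by (simp add: trivial_limit_within)
    have "(G \<longlongrightarrow> G x) (at x within closure \<Omega>)" using G(1) x(1) by (simp add: continuous_on_def)
    then have "(G \<longlongrightarrow> G x) (at x within \<Omega>)" using tendsto_within_subset closure_subset by blast
    then show "(grad u \<longlongrightarrow> G x) (at x within \<Omega>)"
      by (rule Lim_transform_eventually) (auto simp: eventually_at_filter G(2))
  qed
  with G that show ?thesis by blast
qed

lemma norm_grad2: "(norm (grad u x))\<^sup>2 = (\<Sum>i\<in>UNIV. (partial i u x)\<^sup>2)"
  by (simp add: norm_vec_power2 grad_def)

section \<open>Gradient estimate and Hessian on one component\<close>

context
  fixes N
  assumes N: "N \<in> components (\<Omega> - MAXset \<Omega> u)"
begin

lemma N_open: "open N"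
  using open_components[OF open_nonmax N] .

lemma N_sub: "N \<subseteq> \<Omega>"
  using in_components_subset[OF N] by blast

lemma N_less_max: "x \<in> N \<Longrightarrow> u x < umax \<Omega> u"
  using in_components_subset[OF N] u_le_max by (force simp: MAXset_def)

text \<open>Components are relatively closed, so within \<Omega> the component \<open>N\<close> can
  only be left through a maximum point.\<close>

lemma N_closure: "x \<in> closure N \<Longrightarrow> x \<in> \<Omega> \<Longrightarrow> x \<notin> N \<Longrightarrow> x \<in> MAXset \<Omega> u"
  using closedin_component[OF N] by (auto simp: closedin_limpt closure_def)

text \<open>The gradient extends continuously to the compact closure, so both nested suprema are
  taken over bounded sets and are genuine upper bounds.\<close>

lemma bgrad_le_nwss:
  assumes x: "x \<in> frontier \<Omega>" "x \<in> closure N"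
  shows "norm (bgrad \<Omega> u x) \<le> nwss \<Omega> u N * sqrt (2 * umax \<Omega> u)"
proof -
  obtain G where G: "continuous_on (closure \<Omega>) G" "\<And>x. x \<in> frontier \<Omega> \<Longrightarrow> bgrad \<Omega> u x = G x"
    using gradient_extension by metis
  have "compact (G ` closure \<Omega>)" using compact_continuous_image G(1) compact_closure_domain by blast
  then obtain C where "\<And>y. y \<in> G ` closure \<Omega> \<Longrightarrow> norm y \<le> C"
    using compact_imp_bounded bounded_iff by metis
  then have C: "norm (bgrad \<Omega> u y) \<le> C" if "y \<in> frontier \<Omega>" for y
    using G(2)[OF that] that by (auto simp: frontier_def)
  let ?s = "sqrt (2 * umax \<Omega> u)"
  have s: "?s > 0" using umax_pos by simp
  let ?F = "frontier \<Omega> \<inter> closure N"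
  have bd: "bdd_above ((\<lambda>p. norm (bgrad \<Omega> u p)) ` S)" if "S \<subseteq> ?F" for S
    using that C by (intro bdd_aboveI[of _ C]) auto
  have le: "nwss_bdry \<Omega> u S \<le> C / ?s" if "S \<in> components ?F" for S
  proof -
    have "S \<noteq> {}" "S \<subseteq> ?F" using in_components_nonempty[OF that] in_components_subset[OF that] by auto
    then have "Sup ((\<lambda>p. norm (bgrad \<Omega> u p)) ` S) \<le> C"
      by (intro cSup_least) (use C in auto)
    then show ?thesis unfolding nwss_bdry_def using s by (intro divide_right_mono) auto
  qed
  define S where "S = connected_component_set ?F x"
  have S: "S \<in> components ?F" "x \<in> S" using x by (auto simp: S_def components_def)
  have "norm (bgrad \<Omega> u x) \<le> Sup ((\<lambda>p. norm (bgrad \<Omega> u p)) ` S)"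
    using S(2) bd[OF in_components_subset[OF S(1)]] by (intro cSup_upper) auto
  also have "\<dots> = nwss_bdry \<Omega> u S * ?s" using s umax_pos by (simp add: nwss_bdry_def)
  also have "nwss_bdry \<Omega> u S \<le> nwss \<Omega> u N" unfolding nwss_def
    using S(1) le by (intro cSup_upper bdd_aboveI[of _ "C / ?s"]) auto
  finally show ?thesis using s by (simp add: mult_right_mono)
qed

lemma gradient_estimate:
  assumes nw: "nwss \<Omega> u N \<le> 1" and x: "x \<in> N"
  shows "(\<Sum>i\<in>UNIV. (partial i u x)\<^sup>2) \<le> 2 * (umax \<Omega> u - u x)"
proof -
  obtain G where G: "continuous_on (closure \<Omega>) G" "\<And>x. x \<in> \<Omega> \<Longrightarrow> G x = grad u x"
    "\<And>x. x \<in> frontier \<Omega> \<Longrightarrow> bgrad \<Omega> u x = G x"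
    using gradient_extension by metis
  define P where "P = (\<lambda>x. (norm (G x))\<^sup>2 + 2 * u x)"
  have cl: "closure N \<subseteq> closure \<Omega>" using N_sub by (rule closure_mono)
  have "P x \<le> 2 * umax \<Omega> u"
  proof (rule P_function_max_principle[OF opn pd1 pd2 cont_u' cont_partial cont_second laplace N_open _ N_sub _ _ _ x])
    show "bounded N" using bdd N_sub bounded_subset by blast
    show "continuous_on (closure N) P" unfolding P_def
      by (intro continuous_intros continuous_on_subset[OF G(1) cl] continuous_on_subset[OF cont_u cl])
    show "P y = (\<Sum>i\<in>UNIV. (partial i u y)\<^sup>2) + 2 * u y" if "y \<in> N" for y
      using that N_sub G(2) by (auto simp: P_def norm_grad2)
    fix y assume "y \<in> frontier N"
    then have y: "y \<in> closure N" "y \<notin> N" using N_open by (auto simp: frontier_def interior_open)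
    show "P y \<le> 2 * umax \<Omega> u"
    proof (cases "y \<in> \<Omega>")
      case True
      then have m: "y \<in> MAXset \<Omega> u" using N_closure y by blast
      then have "(norm (G y))\<^sup>2 = 0" using G(2)[OF True] partial_zero_at_max[OF m] norm_grad2[of y] by simp
      then show ?thesis using m by (simp add: P_def MAXset_def)
    next
      case False
      then have f: "y \<in> frontier \<Omega>" using y(1) cl opn by (auto simp: frontier_def interior_open)
      have "norm (G y) \<le> nwss \<Omega> u N * sqrt (2 * umax \<Omega> u)" using bgrad_le_nwss[OF f y(1)] G(3)[OF f] by simp
      also have "\<dots> \<le> 1 * sqrt (2 * umax \<Omega> u)" using nw umax_pos by (intro mult_right_mono) auto
      finally have "(norm (G y))\<^sup>2 \<le> (sqrt (2 * umax \<Omega> u))\<^sup>2" by (intro power_mono) auto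
      then show ?thesis using umax_pos u_frontier[OF f] by (simp add: P_def)
    qed
  qed
  then show ?thesis using G(2) x N_sub norm_grad2[of x] by (auto simp: P_def)
qed

text \<open>At the point \<open>p\<close> of the maximum set nearest to some point of \<open>N\<close>, the component \<open>N\<close> contains
  a ball touching \<open>p\<close>. Hence the second-order expansion of the gradient estimate at \<open>p\<close> holds in a
  half-space of directions, and by homogeneity of degree two in every direction.\<close>
lemma hessian_at_touching_point:
  assumes nw: "nwss \<Omega> u N \<le> 1"
  obtains p where "p \<in> MAXset \<Omega> u" "p \<in> closure N" "\<And>i v. frechet_derivative (partial i u) (at p) v = - v $ i"
proof -
  obtain m where "m \<in> \<Omega>" "u m = umax \<Omega> u" using max_attained by blast
  then have "m \<in> \<Omega> - N" using N_less_max by force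
  moreover have "\<Omega> \<inter> N \<noteq> {}" using N_sub in_components_nonempty[OF N] by blast
  ultimately obtain p0 where p0: "p0 \<in> \<Omega>" "p0 \<in> frontier N"
    using connected_Int_frontier[OF con] by blast
  have p0N: "p0 \<in> closure N" "p0 \<notin> N" using p0 N_open by (auto simp: frontier_def interior_open)
  obtain d where d: "d > 0" "ball p0 d \<subseteq> \<Omega>" using opn p0(1) openE by blast
  \<comment> \<open>Being within d/2 of p0 keeps the point of the complement nearest to q inside
    \<open>ball p0 d\<close>, hence in \<Omega>: it is a maximum point and not a frontier point of
    \<Omega>.\<close>
  obtain q where q: "q \<in> N" "dist q p0 < d/2" using p0N(1) d(1) closure_approachable half_gt_zero by metis
  have "closed (- N)" using N_open by (simp add: closed_Compl)
  then obtain p where p: "p \<in> - N" "\<And>y. y \<in> - N \<Longrightarrow> dist q p \<le> dist q y"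
    using distance_attains_inf[of "- N" q] p0N(2) by blast
  define r where "r = dist q p"
  have r: "r > 0" using q(1) p(1) by (auto simp: r_def)
  have "r < d/2" using p(2)[of p0] p0N(2) q(2) by (simp add: r_def)
  then have "dist p0 p < d" using dist_triangle[of p0 p q] q(2) by (simp add: r_def dist_commute)
  then have p\<Omega>: "p \<in> \<Omega>" using d by auto
  have ballN: "ball q r \<subseteq> N" using p(2) by (force simp: r_def)
  have "p \<in> cball q r" by (simp add: r_def)
  then have "p \<in> closure (ball q r)" using r by simp
  then have pcl: "p \<in> closure N" using closure_mono[OF ballN] by blast
  have pM: "p \<in> MAXset \<Omega> u" using N_closure pcl p\<Omega> p(1) by blast
  then have up: "u p = umax \<Omega> u" by (simp add: MAXset_def)
  obtain e where e: "e > 0" "ball p e \<subseteq> \<Omega>" using opn p\<Omega> openE by blast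
  define B where "B = (\<lambda>i. frechet_derivative (partial i u) (at p))"
  have lin: "linear (B i)" for i unfolding B_def by (rule linear_frechet_derivative[OF diff_partial[OF p\<Omega>]])
  \<comment> \<open>With H the Hessian at p, \<open>B i v\<close> is the i-th component of H v and
    \<open>Q v\<close> is |H v|^2 + v . H v.\<close>
  define Q where "Q = (\<lambda>v. (\<Sum>i\<in>UNIV. (B i v)\<^sup>2) + (\<Sum>i\<in>UNIV. v $ i * B i v))"
  have half: "Q v \<le> 0" if v: "(q - p) \<bullet> v > 0" for v
  proof -
    have v0: "norm v > 0" using v by auto
    have in\<Omega>: "p + t *\<^sub>R v \<in> \<Omega>" if "\<bar>t\<bar> < e / norm v" for t
    proof -
      have "norm (t *\<^sub>R v) < e" using that v0 by (simp add: pos_less_divide_eq)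
      then have "p + t *\<^sub>R v \<in> ball p e" by (simp add: dist_norm)
      then show ?thesis using e by blast
    qed
    have ev: "e / norm v > 0" using e v0 by simp
    have dir: "((\<lambda>t. partial i u (p + t *\<^sub>R v)) has_real_derivative B i v) (at 0)" for i
      using differentiable_has_derivative_along[of "partial i u" p 0 v] diff_partial[OF p\<Omega>] by (simp add: B_def)
    have L1: "((\<lambda>t. partial i u (p + t *\<^sub>R v) / t) \<longlongrightarrow> B i v) (at_right 0)" for i
    proof -
      have "((\<lambda>t. partial i u (p + t *\<^sub>R v) / t) \<longlongrightarrow> B i v) (at 0)"
        using dir[of i] partial_zero_at_max[OF pM, of i] by (simp add: has_field_derivative_iff)
      then show ?thesis by (rule tendsto_mono[rotated]) (simp add: at_le)
    qed
    have L2: "((\<lambda>t. 2 * (u (p + 0 *\<^sub>R v) - u (p + t *\<^sub>R v)) / t\<^sup>2) \<longlongrightarrow> - (\<Sum>i\<in>UNIV. v $ i * B i v)) (at_right 0)"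
    proof (rule second_order_quotient_at_right[OF ev])
      fix s assume "\<bar>s\<bar> < e / norm v"
      then have "p + s *\<^sub>R v \<in> \<Omega>" by (rule in\<Omega>)
      then show "((\<lambda>s. u (p + s *\<^sub>R v)) has_real_derivative (\<Sum>i\<in>UNIV. v $ i * partial i u (p + s *\<^sub>R v))) (at s)"
        by (rule u_along)
    next
      show "((\<lambda>s. \<Sum>i\<in>UNIV. v $ i * partial i u (p + s *\<^sub>R v)) has_real_derivative (\<Sum>i\<in>UNIV. v $ i * B i v)) (at 0)"
        by (intro DERIV_sum DERIV_cmult dir)
    qed (simp add: partial_zero_at_max[OF pM])
    have L3: "((\<lambda>t. \<Sum>i\<in>UNIV. (partial i u (p + t *\<^sub>R v) / t)\<^sup>2) \<longlongrightarrow> (\<Sum>i\<in>UNIV. (B i v)\<^sup>2)) (at_right 0)"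
      by (intro tendsto_intros L1)
    \<comment> \<open>For positive t, the point p + t v lies in \<open>ball q r\<close> exactly when
      t < t0.\<close>
    define t0 where "t0 = 2 * ((q - p) \<bullet> v) / (norm v)\<^sup>2"
    have t0: "t0 > 0" using v v0 by (simp add: t0_def)
    have inN: "p + t *\<^sub>R v \<in> N" if "0 < t" "t < t0" for t
    proof -
      have "t * (norm v)\<^sup>2 < 2 * ((q - p) \<bullet> v)" using that v0 by (simp add: t0_def pos_less_divide_eq)
      then have "t * (t * (norm v)\<^sup>2) < t * (2 * ((q - p) \<bullet> v))" using that by simp
      moreover have "(norm (q - (p + t *\<^sub>R v)))\<^sup>2 = (norm (q - p))\<^sup>2 - t * (2 * ((q - p) \<bullet> v)) + t * (t * (norm v)\<^sup>2)"
        unfolding power2_norm_eq_inner by (simp add: algebra_simps inner_commute)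
      ultimately have "(norm (q - (p + t *\<^sub>R v)))\<^sup>2 < r\<^sup>2" by (simp add: r_def dist_norm)
      then have "p + t *\<^sub>R v \<in> ball q r" using r by (simp add: dist_norm power2_less_imp_less)
      then show ?thesis using ballN by blast
    qed
    have "(\<Sum>i\<in>UNIV. (B i v)\<^sup>2) \<le> - (\<Sum>i\<in>UNIV. v $ i * B i v)"
    proof (rule tendsto_le[OF _ L2 L3])
      show "\<forall>\<^sub>F t in at_right 0. (\<Sum>i\<in>UNIV. (partial i u (p + t *\<^sub>R v) / t)\<^sup>2) \<le> 2 * (u (p + 0 *\<^sub>R v) - u (p + t *\<^sub>R v)) / t\<^sup>2"
        using eventually_at_right_real[OF t0]
      proof eventually_elim
        case (elim t)
        then have "(\<Sum>i\<in>UNIV. (partial i u (p + t *\<^sub>R v))\<^sup>2) \<le> 2 * (umax \<Omega> u - u (p + t *\<^sub>R v))"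
          by (intro gradient_estimate nw inN) auto
        then have "(\<Sum>i\<in>UNIV. (partial i u (p + t *\<^sub>R v))\<^sup>2) / t\<^sup>2 \<le> 2 * (umax \<Omega> u - u (p + t *\<^sub>R v)) / t\<^sup>2"
          by (intro divide_right_mono) auto
        then show ?case by (simp add: up power_divide sum_divide_distrib)
      qed
    qed simp
    then show ?thesis by (simp add: Q_def)
  qed
  have Qc: "continuous_on A Q" for A unfolding Q_def
    by (intro continuous_intros linear_continuous_on linear_conv_bounded_linear[THEN iffD1] lin)
  have qp: "q - p \<noteq> 0" using r by (auto simp: r_def)
  have half': "Q v \<le> 0" if "(q - p) \<bullet> v \<ge> 0" for v
    by (rule continuous_le_on_closure[OF Qc, of v "{v. (q - p) \<bullet> v > 0}"])
       (use that qp half in \<open>auto simp: closure_halfspace_gt\<close>)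
  have even: "Q (- v) = Q v" for v by (simp add: Q_def linear_neg[OF lin])
  have all: "Q v \<le> 0" for v
    using half'[of v] half'[of "- v"] even[of v] by (cases "(q - p) \<bullet> v \<ge> 0") auto
  have Bax: "B k (axis i 1) = partial i (partial k u) p" for i k by (simp add: B_def partial_def)
  \<comment> \<open>Coordinate vectors show that a diagonal entry b satisfies b^2 + b \<le> 0, so b
    \<ge> -1. The trace makes every b equal to -1, and the same inequality then leaves no room for
    off-diagonal entries.\<close>
  have ax: "(\<Sum>k\<in>UNIV. (B k (axis i 1))\<^sup>2) + B i (axis i 1) \<le> 0" for i
  proof -
    have "(\<Sum>k\<in>UNIV. axis i 1 $ k * B k (axis i 1)) = (\<Sum>k\<in>UNIV. if k = i then B k (axis i 1) else 0)"
      by (intro sum.cong) (auto simp: axis_def)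
    then show ?thesis using all[of "axis i 1"] by (simp add: Q_def)
  qed
  have ge: "B i (axis i 1) + 1 \<ge> 0" for i
  proof -
    have "(B i (axis i 1))\<^sup>2 \<le> (\<Sum>k\<in>UNIV. (B k (axis i 1))\<^sup>2)" by (rule member_le_sum) auto
    then have b: "B i (axis i 1) * (B i (axis i 1) + 1) \<le> 0"
      using ax[of i] by (simp add: power2_eq_square algebra_simps)
    show ?thesis
    proof (rule ccontr)
      assume "\<not> ?thesis"
      then have "B i (axis i 1) * (B i (axis i 1) + 1) > 0" by (intro mult_neg_neg) auto
      with b show False by simp
    qed
  qed
  have "(\<Sum>i\<in>UNIV. B i (axis i 1) + 1) = 0" using laplace[OF p\<Omega>] by (simp add: Bax sum.distrib)
  then have sum0: "\<forall>i\<in>UNIV. B i (axis i 1) + 1 = 0"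
    using ge by (subst (asm) sum_nonneg_eq_0_iff) auto
  have diag: "B i (axis i 1) = - 1" for i
  proof -
    have "B i (axis i 1) + 1 = 0" using sum0 by blast
    then show ?thesis by linarith
  qed
  have off: "B k (axis i 1) = 0" if "k \<noteq> i" for i k
  proof -
    have "(\<Sum>k\<in>{i, k}. (B k (axis i 1))\<^sup>2) \<le> (\<Sum>k\<in>UNIV. (B k (axis i 1))\<^sup>2)" by (rule sum_mono2) auto
    moreover have "(\<Sum>k\<in>{i, k}. (B k (axis i 1))\<^sup>2) = 1 + (B k (axis i 1))\<^sup>2" using that diag[of i] by auto
    ultimately have "(B k (axis i 1))\<^sup>2 \<le> 0" using ax[of i] diag[of i] by linarith
    then show ?thesis by simp
  qed
  have hess: "frechet_derivative (partial i u) (at p) v = - v $ i" for i v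
  proof -
    have "frechet_derivative (partial i u) (at p) v = (\<Sum>j\<in>UNIV. v $ j * B i (axis j 1))"
      by (simp add: frechet_derivative_eq_sum_partial[OF diff_partial[OF p\<Omega>]] Bax)
    also have "\<dots> = (\<Sum>j\<in>UNIV. if j = i then - v $ j else 0)"
      by (intro sum.cong) (auto simp: diag off)
    finally show ?thesis by simp
  qed
  show ?thesis by (rule that[OF pM pcl hess])
qed

end

end

section \<open>Rigidity: the domain is a ball\<close>

text \<open>Radial projection onto a ball is nonexpansive and fixes z. In
  \<open>ball_rigidity\<close> it keeps a point close to the sphere inside the same small ball when
  it is pulled back to the sphere.\<close>

lemma dist_radial_projection_le:
  fixes x z :: "'a::real_inner"
  assumes "norm z = \<rho>" "\<rho> \<le> norm x" "0 < \<rho>"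
  shows "dist z ((\<rho> / norm x) *\<^sub>R x) \<le> dist z x"
proof -
  define s where "s = norm x"
  have s: "s > 0" "\<rho> \<le> s" using assms by (auto simp: s_def)
  define y where "y = (\<rho> / s) *\<^sub>R x"
  have xy: "x = (s / \<rho>) *\<^sub>R y" "norm y = \<rho>" using s assms by (auto simp: y_def s_def)
  have "(norm (z - x))\<^sup>2 - (norm (z - y))\<^sup>2 = s\<^sup>2 - \<rho>\<^sup>2 - 2 * (s / \<rho> - 1) * (z \<bullet> y)"
  proof -
    have "(norm (z - x))\<^sup>2 = (norm z)\<^sup>2 - 2 * (z \<bullet> x) + (norm x)\<^sup>2" "(norm (z - y))\<^sup>2 = (norm z)\<^sup>2 - 2 * (z \<bullet> y) + (norm y)\<^sup>2"
      unfolding power2_norm_eq_inner by (simp_all add: algebra_simps inner_commute)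
    moreover have "z \<bullet> x = (s / \<rho>) * (z \<bullet> y)" by (subst xy(1)) simp
    moreover have "(norm x)\<^sup>2 = s\<^sup>2" by (simp add: s_def)
    ultimately show ?thesis using xy(2) by (simp add: algebra_simps)
  qed
  also have "\<dots> \<ge> s\<^sup>2 - \<rho>\<^sup>2 - 2 * (s / \<rho> - 1) * \<rho>\<^sup>2"
  proof -
    have "z \<bullet> y \<le> norm z * norm y" by (rule norm_cauchy_schwarz)
    also have "\<dots> = \<rho>\<^sup>2" using assms xy by (simp add: power2_eq_square)
    finally have zy: "z \<bullet> y \<le> \<rho>\<^sup>2" .
    have "s / \<rho> \<ge> 1" using s assms(3) by (simp add: le_divide_eq)
    then have "2 * (s / \<rho> - 1) * (z \<bullet> y) \<le> 2 * (s / \<rho> - 1) * \<rho>\<^sup>2"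
      using zy by (intro mult_left_mono) auto
    then show ?thesis by linarith
  qed
  also have "s\<^sup>2 - \<rho>\<^sup>2 - 2 * (s / \<rho> - 1) * \<rho>\<^sup>2 = (s - \<rho>)\<^sup>2"
    using assms by (simp add: power2_eq_square field_simps)
  finally have "(norm (z - y))\<^sup>2 \<le> (norm (z - x))\<^sup>2" using zero_le_power2[of "s - \<rho>"] by linarith
  then have "norm (z - y) \<le> norm (z - x)" by (rule power2_le_imp_le) simp
  then show ?thesis by (simp add: dist_norm y_def s_def)
qed

context torsion
begin

text \<open>The Hessian gives grad u (p + w) = - w + o(|w|), and the mean value theorem on the
  segment from p turns this into a strict decrease of u.\<close>

lemma strict_max_of_hessian:
  assumes pM: "p \<in> MAXset \<Omega> u" and H: "\<And>i v. frechet_derivative (partial i u) (at p) v = - v $ i"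
  obtains e where "e > 0" "ball p e \<subseteq> \<Omega>" "\<And>x. x \<in> ball p e \<Longrightarrow> x \<noteq> p \<Longrightarrow> u x < umax \<Omega> u"
proof -
  have p: "p \<in> \<Omega>" "u p = umax \<Omega> u" using pM by (auto simp: MAXset_def)
  let ?n = "real CARD('n)"
  \<comment> \<open>The n coordinate errors then add up to half of the main term.\<close>
  define \<epsilon> where "\<epsilon> = 1 / (2 * ?n)"
  have \<epsilon>: "\<epsilon> > 0" by (simp add: \<epsilon>_def)
  have "\<exists>d>0. \<forall>y. norm (y - p) < d \<longrightarrow> \<bar>partial i u y + (y - p) $ i\<bar> \<le> \<epsilon> * norm (y - p)" for i
  proof -
    have "(partial i u has_derivative frechet_derivative (partial i u) (at p)) (at p)"
      using diff_partial[OF p(1)] frechet_derivative_works by blast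
    then obtain d where "d > 0" "\<And>y. norm (y - p) < d \<Longrightarrow>
        norm (partial i u y - partial i u p - frechet_derivative (partial i u) (at p) (y - p)) \<le> \<epsilon> * norm (y - p)"
      using \<epsilon> unfolding has_derivative_at_alt by blast
    then show ?thesis using partial_zero_at_max[OF pM, of i] by (intro exI[of _ d]) (auto simp: H diff_diff_eq2 add_diff_eq)
  qed
  then obtain d where d: "\<And>i. d i > 0"
    "\<And>i y. norm (y - p) < d i \<Longrightarrow> \<bar>partial i u y + (y - p) $ i\<bar> \<le> \<epsilon> * norm (y - p)" by metis
  obtain e0 where e0: "e0 > 0" "ball p e0 \<subseteq> \<Omega>" using opn p(1) openE by blast
  define e where "e = min e0 (Min (range d))"
  have e: "e > 0" "e \<le> e0" "\<And>i. e \<le> d i"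
    using e0 d(1) by (auto simp: e_def Min_gr_iff intro: min.coboundedI2)
  have sub: "ball p e \<subseteq> \<Omega>" using e0 e(2) subset_ball[of e e0 p] by blast
  have "u x < umax \<Omega> u" if x: "x \<in> ball p e" "x \<noteq> p" for x
  proof -
    define v where "v = x - p"
    have v: "norm v < e" "norm v > 0" using x by (auto simp: v_def dist_norm norm_minus_commute)
    have inb: "norm (s *\<^sub>R v) < e" if "0 \<le> s" "s \<le> 1" for s
    proof -
      have "s * norm v \<le> 1 * norm v" using that by (intro mult_right_mono) auto
      then have "s * norm v < e" using v(1) by linarith
      then show ?thesis using that by simp
    qed
    have in\<Omega>: "p + s *\<^sub>R v \<in> \<Omega>" if "0 \<le> s" "s \<le> 1" for s
    proof -
      have "p + s *\<^sub>R v \<in> ball p e" using inb[OF that] by (simp add: dist_norm)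
      then show ?thesis using sub by blast
    qed
    have "\<exists>s. s > 0 \<and> s < 1 \<and> u (p + 1 *\<^sub>R v) - u (p + 0 *\<^sub>R v) = (1 - 0) * (\<Sum>i\<in>UNIV. v $ i * partial i u (p + s *\<^sub>R v))"
      by (rule MVT2) (auto intro!: u_along in\<Omega>)
    then obtain s where s: "s > 0" "s < 1" "u x - u p = (\<Sum>i\<in>UNIV. v $ i * partial i u (p + s *\<^sub>R v))"
      by (auto simp: v_def)
    have "v $ i * partial i u (p + s *\<^sub>R v) \<le> s * (\<epsilon> * (norm v)\<^sup>2) - s * (v $ i)\<^sup>2" for i
    proof -
      have "\<bar>partial i u (p + s *\<^sub>R v) + s * v $ i\<bar> \<le> \<epsilon> * (s * norm v)"
        using d(2)[of "p + s *\<^sub>R v" i] inb[of s] e(3)[of i] s by auto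
      then have "\<bar>v $ i\<bar> * \<bar>partial i u (p + s *\<^sub>R v) + s * v $ i\<bar> \<le> norm v * (\<epsilon> * (s * norm v))"
        using s \<epsilon> component_le_norm_cart[of v i] by (intro mult_mono) auto
      then have "v $ i * (partial i u (p + s *\<^sub>R v) + s * v $ i) \<le> norm v * (\<epsilon> * (s * norm v))"
        by (simp flip: abs_mult)
      then show ?thesis by (simp add: power2_eq_square algebra_simps)
    qed
    then have "u x - u p \<le> (\<Sum>i\<in>UNIV. s * (\<epsilon> * (norm v)\<^sup>2) - s * (v $ i)\<^sup>2)" unfolding s(3) by (intro sum_mono)
    also have "\<dots> = ?n * (s * (\<epsilon> * (norm v)\<^sup>2)) - s * (norm v)\<^sup>2"
      by (simp add: sum_subtractf norm_vec_power2 sum_distrib_left)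
    also have "\<dots> = - (s * (norm v)\<^sup>2 / 2)" by (simp add: \<epsilon>_def)
    also have "\<dots> < 0" using s v by simp
    finally show ?thesis using p by simp
  qed
  with that e(1) sub show ?thesis by blast
qed

text \<open>With \<open>g = umax - u - |x - p|\<^sup>2 / 2\<close> the gradient estimate reads \<open>(x - p) \<bullet> grad g \<le> g\<close>,
  so \<open>g / |x - p|\<close> is nonincreasing along rays from \<open>p\<close>. This makes \<open>g\<close> nonpositive wherever it is
  continued outwards from its zero set, and the strong maximum principle turns that into \<open>g = 0\<close>.\<close>
lemma ball_rigidity:
  assumes n: "CARD('n) \<ge> 2" and N: "N \<in> components (\<Omega> - MAXset \<Omega> u)" and nw: "nwss \<Omega> u N \<le> 1"
  obtains p \<rho> where "\<rho> > 0" "\<Omega> = ball p \<rho>" "\<And>x. x \<in> \<Omega> \<Longrightarrow> u x = (\<rho>\<^sup>2 - (norm (x - p))\<^sup>2) / 2"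
proof -
  obtain p where pM: "p \<in> MAXset \<Omega> u" and pcl: "p \<in> closure N"
    and H: "\<And>i v. frechet_derivative (partial i u) (at p) v = - v $ i"
    using hessian_at_touching_point[OF N nw] by blast
  obtain e where e: "e > 0" "ball p e \<subseteq> \<Omega>" "\<And>x. x \<in> ball p e \<Longrightarrow> x \<noteq> p \<Longrightarrow> u x < umax \<Omega> u"
    using strict_max_of_hessian[OF pM H] by blast
  have p: "p \<in> \<Omega>" "u p = umax \<Omega> u" using pM by (auto simp: MAXset_def)
  have pN: "p \<notin> N" using N_less_max[OF N, of p] p(2) by auto
  \<comment> \<open>In dimension at least two the punctured ball is connected. It avoids the maximum
    set and meets \<open>N\<close>, so it lies in \<open>N\<close>, and adding p to \<open>N\<close>
    gives an open set.\<close>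
  have punc: "ball p e - {p} \<subseteq> N"
  proof (rule components_maximal[OF N])
    show "connected (ball p e - {p})" using n by (intro connected_punctured_ball) simp
    show "ball p e - {p} \<subseteq> \<Omega> - MAXset \<Omega> u" using e by (force simp: MAXset_def)
    obtain y where "y \<in> N" "dist y p < e" using pcl e(1) closure_approachable by blast
    then have "y \<in> N \<inter> (ball p e - {p})" using pN by (auto simp: dist_commute)
    then show "N \<inter> (ball p e - {p}) \<noteq> {}" by blast
  qed
  define N' where "N' = insert p N"
  have N'eq: "N' = N \<union> ball p e" using punc e(1) by (auto simp: N'_def)
  have N'open: "open N'" unfolding N'eq using N_open[OF N] by blast
  have N'sub: "N' \<subseteq> \<Omega>" using N_sub[OF N] p(1) by (simp add: N'_def)
  have grad_est: "(\<Sum>i\<in>UNIV. (partial i u x)\<^sup>2) \<le> 2 * (umax \<Omega> u - u x)" if "x \<in> N'" for x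
    using that gradient_estimate[OF N nw, of x] partial_zero_at_max[OF pM] p(2) by (auto simp: N'_def)

  define g where "g = (\<lambda>x. umax \<Omega> u - u x - (1/2) * (norm (x - p))\<^sup>2)"
  define g1 where "g1 = (\<lambda>i x. 0 - partial i u x - (1/2) * (2 * (x $ i - p $ i)))"
  define g2 where "g2 = (\<lambda>i x. 0 - partial i (partial i u) x - (1/2) * (2 * 1))"
  have gp: "g p = 0" by (simp add: g_def p(2))
  have G1: "has_pd i g (g1 i x) x" if "x \<in> \<Omega>" for i x unfolding g_def g1_def
    by (intro has_pd_diff has_pd_const has_pd_cmult has_pd_norm2 pd1 that)
  have G2: "has_pd i (g1 i) (g2 i x) x" if "x \<in> \<Omega>" for i x unfolding g1_def g2_def
    by (intro has_pd_diff has_pd_const has_pd_cmult has_pd_component pd2 that)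
  have G3: "(\<Sum>i\<in>UNIV. g2 i x) = 0" if "x \<in> \<Omega>" for x
    using laplace[OF that] by (simp add: g2_def sum_subtractf sum_negf)
  have Gc: "continuous_on (closure \<Omega>) g" unfolding g_def by (intro continuous_intros cont_u)
  have Gdir: "((\<lambda>t. g (p + t *\<^sub>R v)) has_real_derivative (\<Sum>i\<in>UNIV. v $ i * g1 i (p + t *\<^sub>R v))) (at t)"
    if "p + t *\<^sub>R v \<in> \<Omega>" for t v
  proof -
    have eq: "(\<lambda>t. g (p + t *\<^sub>R v)) = (\<lambda>t. umax \<Omega> u - u (p + t *\<^sub>R v) - (1/2) * (t\<^sup>2 * (norm v)\<^sup>2))"
      by (auto simp: g_def power_mult_distrib)
    have 1: "((\<lambda>t. u (p + t *\<^sub>R v)) has_real_derivative (\<Sum>i\<in>UNIV. v $ i * partial i u (p + t *\<^sub>R v))) (at t)"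
      by (rule u_along[OF that])
    have "((\<lambda>t. g (p + t *\<^sub>R v)) has_real_derivative
        0 - (\<Sum>i\<in>UNIV. v $ i * partial i u (p + t *\<^sub>R v)) - (1/2) * (2 * t * (norm v)\<^sup>2)) (at t)"
      unfolding eq by (intro DERIV_diff DERIV_const 1 DERIV_cmult) (auto intro!: derivative_eq_intros)
    moreover have "0 - (\<Sum>i\<in>UNIV. v $ i * partial i u (p + t *\<^sub>R v)) - (1/2) * (2 * t * (norm v)\<^sup>2)
        = (\<Sum>i\<in>UNIV. v $ i * g1 i (p + t *\<^sub>R v))"
    proof -
      have "v $ i * g1 i (p + t *\<^sub>R v) = - (v $ i * partial i u (p + t *\<^sub>R v)) - t * (v $ i)\<^sup>2" for i
        by (simp add: g1_def power2_eq_square algebra_simps)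
      then show ?thesis by (simp add: sum_subtractf sum_negf norm_vec_power2 sum_distrib_left)
    qed
    ultimately show ?thesis by (simp only:)
  qed
  have radial: "(\<Sum>i\<in>UNIV. (x - p) $ i * g1 i x) \<le> g x" if "x \<in> N'" for x
  proof -
    \<comment> \<open>The two summands differ by half of the square of
      \<open>partial i u x + (x - p) $ i\<close>.\<close>
    have "(\<Sum>i\<in>UNIV. (x - p) $ i * g1 i x) \<le> (\<Sum>i\<in>UNIV. (1/2) * (partial i u x)\<^sup>2 - (1/2) * ((x - p) $ i)\<^sup>2)"
    proof (rule sum_mono)
      fix i
      show "(x - p) $ i * g1 i x \<le> (1/2) * (partial i u x)\<^sup>2 - (1/2) * ((x - p) $ i)\<^sup>2"
        using zero_le_power2[of "partial i u x + (x - p) $ i"]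
        by (simp add: g1_def power2_eq_square algebra_simps)
    qed
    also have "\<dots> = (1/2) * (\<Sum>i\<in>UNIV. (partial i u x)\<^sup>2) - (1/2) * (norm (x - p))\<^sup>2"
      by (simp only: sum_subtractf norm_vec_power2 sum_distrib_left)
    also have "\<dots> \<le> g x" using grad_est[OF that] by (simp add: g_def)
    finally show ?thesis .
  qed
  have ray: "g (p + b *\<^sub>R v) / b \<le> g (p + a *\<^sub>R v) / a"
    if ab: "0 < a" "a \<le> b" and seg: "\<And>t. a \<le> t \<Longrightarrow> t \<le> b \<Longrightarrow> p + t *\<^sub>R v \<in> N'" for a b v
  proof (rule DERIV_nonpos_imp_nonincreasing[OF ab(2)])
    fix t assume t: "a \<le> t" "t \<le> b"
    then have t0: "t > 0" and tN: "p + t *\<^sub>R v \<in> N'" using ab seg by auto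
    let ?D = "\<Sum>i\<in>UNIV. v $ i * g1 i (p + t *\<^sub>R v)"
    have "((\<lambda>t. g (p + t *\<^sub>R v) / t) has_real_derivative (?D * t - g (p + t *\<^sub>R v) * 1) / (t * t)) (at t)"
      using t0 N'sub tN by (intro DERIV_divide Gdir DERIV_ident) auto
    moreover have "?D * t = (\<Sum>i\<in>UNIV. (p + t *\<^sub>R v - p) $ i * g1 i (p + t *\<^sub>R v))"
      by (simp add: sum_distrib_left mult_ac)
    then have "(?D * t - g (p + t *\<^sub>R v) * 1) / (t * t) \<le> 0"
      using radial[OF tN] t0 by (intro divide_nonpos_pos) auto
    ultimately show "\<exists>y. ((\<lambda>t. g (p + t *\<^sub>R v) / t) has_real_derivative y) (at t) \<and> y \<le> 0" by blast
  qed
  have smp: "g x = 0" if "ball z d \<subseteq> N'" "d > 0" "g z = 0" "\<And>y. y \<in> ball z d \<Longrightarrow> g y \<le> 0" "x \<in> ball z d" for x z d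
  proof (rule strong_max_principle[of "ball z d" g g1 g2 z x])
    have "ball z d \<subseteq> \<Omega>" using that(1) N'sub by blast
    then show "\<And>i x. x \<in> ball z d \<Longrightarrow> has_pd i g (g1 i x) x" "\<And>i x. x \<in> ball z d \<Longrightarrow> has_pd i (g1 i) (g2 i x) x"
      "\<And>x. x \<in> ball z d \<Longrightarrow> (\<Sum>i\<in>UNIV. g2 i x) = 0" "continuous_on (ball z d) g"
      using G1 G2 G3 continuous_on_subset[OF Gc] closure_subset by blast+
  qed (use that in auto)

  define good where "good = (\<lambda>\<rho>. \<rho> > 0 \<and> ball p \<rho> \<subseteq> N' \<and> (\<forall>x\<in>ball p \<rho>. g x = 0))"
  have "good e"
  proof -
    have sub: "ball p e \<subseteq> N'" by (simp add: N'eq)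
    \<comment> \<open>Along a ray g (p + t v) / t is nonincreasing, and it tends to 0 as t tends to
      0 because g and its gradient vanish at p.\<close>
    have le: "g x \<le> 0" if x: "x \<in> ball p e" for x
    proof -
      define v where "v = x - p"
      have vle: "norm v < e" using x by (simp add: v_def dist_norm norm_minus_commute)
      have inN: "p + t *\<^sub>R v \<in> N'" if "0 \<le> t" "t \<le> 1" for t
      proof -
        have "t * norm v \<le> 1 * norm v" using that by (intro mult_right_mono) auto
        then have "t * norm v < e" using vle by linarith
        then have "p + t *\<^sub>R v \<in> ball p e" using that by (simp add: dist_norm)
        then show ?thesis using sub by blast
      qed
      have "((\<lambda>t. g (p + t *\<^sub>R v)) has_real_derivative (\<Sum>i\<in>UNIV. v $ i * g1 i (p + 0 *\<^sub>R v))) (at 0)"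
        by (rule Gdir) (simp add: p(1))
      moreover have "(\<Sum>i\<in>UNIV. v $ i * g1 i (p + 0 *\<^sub>R v)) = 0"
        by (simp add: g1_def partial_zero_at_max[OF pM])
      ultimately have "((\<lambda>t. g (p + t *\<^sub>R v) / t) \<longlongrightarrow> 0) (at 0)"
        using gp by (simp add: has_field_derivative_iff)
      then have "((\<lambda>t. g (p + t *\<^sub>R v) / t) \<longlongrightarrow> 0) (at_right 0)"
        by (rule tendsto_mono[rotated]) (simp add: at_le)
      then have "g (p + 1 *\<^sub>R v) / 1 \<le> 0"
      proof (rule tendsto_lowerbound)
        show "\<forall>\<^sub>F t in at_right 0. g (p + 1 *\<^sub>R v) / 1 \<le> g (p + t *\<^sub>R v) / t"
          using eventually_at_right_real[of 0 1, simplified]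
          by eventually_elim (intro ray inN, auto)
      qed simp
      then show ?thesis by (simp add: v_def)
    qed
    have "g x = 0" if "x \<in> ball p e" for x
      by (rule smp[OF sub e(1) gp le that])
    then show ?thesis unfolding good_def using e(1) sub by blast
  qed
  define \<rho> where "\<rho> = Sup (Collect good)"
  have bdg: "bdd_above (Collect good)"
  proof -
    obtain D where D: "\<Omega> \<subseteq> cball p D"
      using bounded_subset_ballD[OF bdd, of p] ball_subset_cball by blast
    have "r \<le> D" if "good r" for r
    proof -
      have "r > 0" "ball p r \<subseteq> cball p D" using that D N'sub unfolding good_def by blast+
      then show ?thesis unfolding ball_subset_cball_iff by simp
    qed
    then show ?thesis by (intro bdd_aboveI[of _ D]) auto
  qed
  have \<rho>ge: "r \<le> \<rho>" if "good r" for r unfolding \<rho>_def using that bdg by (intro cSup_upper) auto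
  have \<rho>0: "\<rho> > 0" using \<rho>ge[OF \<open>good e\<close>] e(1) by linarith
  have in_good: "x \<in> N' \<and> g x = 0" if "x \<in> ball p \<rho>" for x
  proof -
    have "dist p x < Sup (Collect good)" using that by (simp add: \<rho>_def)
    then obtain r where "good r" "dist p x < r" using less_cSup_iff[of "Collect good"] bdg \<open>good e\<close> by blast
    then show ?thesis by (auto simp: good_def)
  qed
  have ballN': "ball p \<rho> \<subseteq> N'" using in_good by blast
  have cb: "cball p \<rho> \<subseteq> closure \<Omega>"
    using closure_mono[of "ball p \<rho>" \<Omega>] ballN' N'sub \<rho>0 by simp
  have g_cball: "g x = 0" if "x \<in> cball p \<rho>" for x
  proof -
    have x: "x \<in> closure (ball p \<rho>)" using that \<rho>0 by simp
    have c: "continuous_on (closure (ball p \<rho>)) g" using continuous_on_subset[OF Gc cb] \<rho>0 by simp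
    have "g x \<le> 0" by (rule continuous_le_on_closure[OF c x]) (use in_good in auto)
    moreover have "g x \<ge> 0" by (rule continuous_ge_on_closure[OF c x]) (use in_good in auto)
    ultimately show ?thesis by simp
  qed
  have u_sphere: "u x = umax \<Omega> u - \<rho>\<^sup>2 / 2" if "x \<in> sphere p \<rho>" for x
    using g_cball[of x] that by (simp add: g_def dist_norm norm_minus_commute)
  \<comment> \<open>Otherwise g would vanish on a larger ball inside \<open>N'\<close>, against the
    choice of \<open>\<rho>\<close> as supremum.\<close>
  have "\<not> sphere p \<rho> \<subseteq> \<Omega>"
  proof
    assume sph: "sphere p \<rho> \<subseteq> \<Omega>"
    \<comment> \<open>A point outside \<open>N'\<close> would be a maximum point, but u is smaller
      than \<open>umax\<close> by \<rho>^2 / 2 on the sphere.\<close>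
    have sphN: "z \<in> N'" if z: "z \<in> sphere p \<rho>" for z
    proof (rule ccontr)
      assume "z \<notin> N'"
      have "z \<in> closure (ball p \<rho>)" using z \<rho>0 by simp
      then have "z \<in> closure N'" using closure_mono[OF ballN'] by blast
      then have "z \<in> closure N" using \<open>z \<notin> N'\<close> by (auto simp: N'_def closure_insert)
      then have "z \<in> MAXset \<Omega> u" using N_closure[OF N] sph z \<open>z \<notin> N'\<close> by (auto simp: N'_def)
      then show False using u_sphere[OF z] \<rho>0 by (simp add: MAXset_def)
    qed
    \<comment> \<open>The largest open subset of \<open>N'\<close> on which g vanishes. Once it
      contains the compact closed ball, it contains a uniform neighbourhood of it.\<close>
    define W where "W = {x. \<exists>d>0. ball x d \<subseteq> N' \<and> (\<forall>y\<in>ball x d. g y = 0)}"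
    have "open W" unfolding open_contains_ball
    proof
      fix x assume "x \<in> W"
      then obtain d where d: "d > 0" "ball x d \<subseteq> N'" "\<And>y. y \<in> ball x d \<Longrightarrow> g y = 0" by (auto simp: W_def)
      have "ball x d \<subseteq> W"
      proof
        fix y assume "y \<in> ball x d"
        then obtain d' where "d' > 0" "ball y d' \<subseteq> ball x d" using openE[OF open_ball] by metis
        then show "y \<in> W" unfolding W_def using d by blast
      qed
      then show "\<exists>d>0. ball x d \<subseteq> W" using d(1) by blast
    qed
    have "cball p \<rho> \<subseteq> W"
    proof
      fix z assume z: "z \<in> cball p \<rho>"
      show "z \<in> W"
      proof (cases "z \<in> ball p \<rho>")
        case True
        then obtain d where "d > 0" "ball z d \<subseteq> ball p \<rho>" using openE[OF open_ball] by metis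
        then show ?thesis unfolding W_def using in_good by blast
      next
        case False
        then have zs: "z \<in> sphere p \<rho>" using z by auto
        obtain d where d: "d > 0" "ball z d \<subseteq> N'" using openE[OF N'open sphN[OF zs]] by blast
        \<comment> \<open>A point x outside the closed ball is pulled back radially to the sphere,
          where g = 0. By convexity the segment between the two stays in \<open>ball z d\<close>, so
          \<open>ray\<close> yields g x \<le> 0.\<close>
        have le: "g x \<le> 0" if x: "x \<in> ball z d" for x
        proof (cases "x \<in> cball p \<rho>")
          case True then show ?thesis using g_cball by simp
        next
          case False
          define v where "v = x - p"
          have v: "\<rho> < norm v" using False by (simp add: v_def dist_norm norm_minus_commute)
          define a where "a = \<rho> / norm v"
          have "norm v > 0" using v \<rho>0 by linarith
          then have a: "0 < a" "a \<le> 1" using v \<rho>0 unfolding a_def by (simp_all del: zero_less_norm_iff)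
          have "dist (z - p) (a *\<^sub>R v) \<le> dist (z - p) v"
            unfolding a_def using v \<rho>0 zs by (intro dist_radial_projection_le) (auto simp: dist_norm norm_minus_commute)
          also have "dist (z - p) v = dist z x" by (simp add: v_def dist_norm)
          finally have "dist z (p + a *\<^sub>R v) \<le> dist z x" by (simp add: dist_norm algebra_simps)
          then have y: "p + a *\<^sub>R v \<in> ball z d" using x by simp
          have seg: "p + t *\<^sub>R v \<in> N'" if t: "a \<le> t" "t \<le> 1" for t
          proof (cases "a = 1")
            case True
            then have "t = 1" using t by simp
            then show ?thesis using x d(2) by (auto simp: v_def)
          next
            case a1: False
            define s where "s = (t - a) / (1 - a)"
            have s: "0 \<le> s" "s \<le> 1" using t a a1 by (auto simp: s_def divide_le_eq_1)
            have "(1 - s) *\<^sub>R (p + a *\<^sub>R v) + s *\<^sub>R x \<in> ball z d"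
              using convex_ball[of z d] y x s by (auto simp: convex_alt)
            moreover have "(1 - s) *\<^sub>R (p + a *\<^sub>R v) + s *\<^sub>R x = p + (a + s * (1 - a)) *\<^sub>R v"
              by (simp add: v_def algebra_simps)
            moreover have "a + s * (1 - a) = t" using a1 by (simp add: s_def)
            ultimately show ?thesis using d(2) by auto
          qed
          have "p + a *\<^sub>R v \<in> cball p \<rho>" using v \<rho>0 by (simp add: a_def dist_norm)
          then have "g (p + a *\<^sub>R v) = 0" by (rule g_cball)
          then show ?thesis using ray[OF a seg] by (simp add: v_def)
        qed
        have "g y = 0" if "y \<in> ball z d" for y
          by (rule smp[OF d(2,1) g_cball[OF z] le that])
        then show ?thesis unfolding W_def using d by blast
      qed
    qed
    then obtain \<epsilon> where \<epsilon>: "\<epsilon> > 0" "(\<Union>x\<in>cball p \<rho>. cball x \<epsilon>) \<subseteq> W"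
      using compact_subset_open_imp_cball_epsilon_subset[OF compact_cball \<open>open W\<close>] by metis
    have "ball p (\<rho> + \<epsilon>) \<subseteq> W"
    proof
      fix x assume x: "x \<in> ball p (\<rho> + \<epsilon>)"
      show "x \<in> W"
      proof (cases "x \<in> cball p \<rho>")
        case True then show ?thesis using \<open>cball p \<rho> \<subseteq> W\<close> by blast
      next
        case False
        define v where "v = x - p"
        have v: "\<rho> < norm v" "norm v < \<rho> + \<epsilon>" using False x by (auto simp: v_def dist_norm norm_minus_commute)
        define y where "y = p + (\<rho> / norm v) *\<^sub>R v"
        have "y \<in> cball p \<rho>" using v \<rho>0 by (simp add: y_def dist_norm)
        moreover have "x \<in> cball y \<epsilon>"
        proof -
          have "y - x = (\<rho> / norm v - 1) *\<^sub>R v" by (simp add: y_def v_def algebra_simps)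
          then have "norm (y - x) = \<bar>\<rho> / norm v - 1\<bar> * norm v" by simp
          also have "\<dots> = \<bar>(\<rho> / norm v - 1) * norm v\<bar>" by (simp only: abs_mult abs_norm_cancel)
          also have "(\<rho> / norm v - 1) * norm v = \<rho> - norm v"
          proof -
            have "(\<rho> / a - 1) * a = \<rho> - a" if "a \<noteq> 0" for a :: real
              using that by (simp add: left_diff_distrib)
            moreover have "norm v \<noteq> 0" using v \<rho>0 by linarith
            ultimately show ?thesis by blast
          qed
          also have "\<bar>\<rho> - norm v\<bar> = norm v - \<rho>" using v by simp
          finally show ?thesis using v by (simp add: dist_norm)
        qed
        ultimately show ?thesis using \<epsilon>(2) by blast
      qed
    qed
    then have "good (\<rho> + \<epsilon>)" unfolding good_def
    proof (intro conjI)
      show "\<rho> + \<epsilon> > 0" using \<rho>0 \<epsilon>(1) by simp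
      have W: "x \<in> N' \<and> g x = 0" if xW: "x \<in> W" for x
      proof -
        obtain d where d: "d > 0" "ball x d \<subseteq> N'" "\<forall>y\<in>ball x d. g y = 0"
          using xW unfolding W_def by blast
        have "x \<in> ball x d" using d(1) by simp
        then show ?thesis using d(2,3) by blast
      qed
      show "ball p (\<rho> + \<epsilon>) \<subseteq> N'" "\<forall>x\<in>ball p (\<rho> + \<epsilon>). g x = 0"
        using W \<open>ball p (\<rho> + \<epsilon>) \<subseteq> W\<close> by blast+
    qed
    then show False using \<rho>ge[of "\<rho> + \<epsilon>"] \<epsilon>(1) by simp
  qed
  then obtain z where z: "z \<in> sphere p \<rho>" "z \<notin> \<Omega>" by blast
  then have "z \<in> frontier \<Omega>" using cb opn by (auto simp: frontier_def interior_open)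
  then have um: "umax \<Omega> u = \<rho>\<^sup>2 / 2" using u_frontier u_sphere[OF z(1)] by simp
  \<comment> \<open>One frontier point on the sphere fixes \<open>umax\<close> = \<rho>^2 / 2, so u
    vanishes on the entire sphere. As u is positive in \<Omega>, the connected set \<Omega> cannot
    cross it.\<close>
  have sphere_out: "x \<notin> \<Omega>" if "x \<in> sphere p \<rho>" for x using u_sphere[OF that] um u_pos[of x] by auto
  have "\<Omega> \<subseteq> ball p \<rho>"
  proof (rule ccontr)
    assume "\<not> ?thesis"
    then have "\<Omega> - ball p \<rho> \<noteq> {}" by blast
    moreover have "\<Omega> \<inter> ball p \<rho> \<noteq> {}" using p(1) \<rho>0 by auto
    ultimately have "\<Omega> \<inter> frontier (ball p \<rho>) \<noteq> {}" using connected_Int_frontier[OF con] by blast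
    then show False using sphere_out \<rho>0 by (auto simp: frontier_ball)
  qed
  then have eq: "\<Omega> = ball p \<rho>" using ballN' N'sub by blast
  have "u x = (\<rho>\<^sup>2 - (norm (x - p))\<^sup>2) / 2" if "x \<in> \<Omega>" for x
    using in_good[of x] that eq um by (auto simp: g_def field_simps)
  with \<rho>0 eq that show ?thesis by blast
qed

lemma equivalent_serrin_of_nwss_le_1:
  assumes n: "CARD('n) \<ge> 2" and N: "N \<in> components (\<Omega> - MAXset \<Omega> u)" and nw: "nwss \<Omega> u N \<le> 1"
  shows "equivalent_sol (ball 0 1) serrin_u \<Omega> u"
proof -
  obtain p \<rho> where \<rho>: "\<rho> > 0" "\<Omega> = ball p \<rho>" "\<And>x. x \<in> \<Omega> \<Longrightarrow> u x = (\<rho>\<^sup>2 - (norm (x - p))\<^sup>2) / 2"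
    using ball_rigidity[OF assms] by blast
  show ?thesis unfolding equivalent_sol_def
  proof (intro exI[of _ \<rho>] exI[of _ p] conjI ballI)
    show "\<Omega> = (\<lambda>x. \<rho> *\<^sub>R x + p) ` ball 0 1"
    proof (intro equalityI subsetI)
      fix x assume "x \<in> \<Omega>"
      then have "norm (x - p) < \<rho>" using \<rho> by (simp add: dist_norm norm_minus_commute)
      then show "x \<in> (\<lambda>x. \<rho> *\<^sub>R x + p) ` ball 0 1"
        using \<rho>(1) by (intro image_eqI[of _ _ "(1/\<rho>) *\<^sub>R (x - p)"]) auto
    next
      fix x assume "x \<in> (\<lambda>x. \<rho> *\<^sub>R x + p) ` ball 0 1"
      then show "x \<in> \<Omega>" using \<rho>(1) by (auto simp: \<rho>(2) dist_norm)
    qed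
    fix y assume "y \<in> \<Omega>"
    moreover have "norm ((1/\<rho>) *\<^sub>R (y - p)) = norm (y - p) / \<rho>" using \<rho>(1) by simp
    ultimately show "u y = \<rho>\<^sup>2 * serrin_u ((1/\<rho>) *\<^sub>R (y - p))"
      using \<rho> by (simp only: serrin_u_def) (simp add: power_divide right_diff_distrib)
  qed (rule \<rho>(1))
qed

section \<open>Shear stress of the Serrin solution\<close>

text \<open>On \<open>ball c s\<close> the gradient is c - x, of length s on the boundary, while 2
  \<open>umax\<close> = s^2. In dimension at least two the punctured ball and the sphere are
  connected, so there is one N and one boundary component.\<close>

lemma nwss_eq_1_of_equivalent_serrin:
  assumes n: "CARD('n) \<ge> 2" and N: "N \<in> components (\<Omega> - MAXset \<Omega> u)"
    and eqv: "equivalent_sol (ball 0 1) serrin_u \<Omega> u"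
  shows "nwss \<Omega> u N = 1"
proof -
  obtain s c where s: "s > 0" and im: "\<Omega> = (\<lambda>x. s *\<^sub>R x + c) ` ball 0 1"
    and us: "\<And>y. y \<in> \<Omega> \<Longrightarrow> u y = s\<^sup>2 * serrin_u ((1/s) *\<^sub>R (y - c))"
    using eqv unfolding equivalent_sol_def by blast
  have \<Omega>: "\<Omega> = ball c s"
  proof (intro equalityI subsetI)
    fix x assume "x \<in> ball c s"
    then have "norm (x - c) < s" by (simp add: dist_norm norm_minus_commute)
    then show "x \<in> \<Omega>" unfolding im
      using s by (intro image_eqI[of _ _ "(1/s) *\<^sub>R (x - c)"]) auto
  next
    fix x assume "x \<in> \<Omega>"
    then show "x \<in> ball c s" using s by (auto simp: im dist_norm)
  qed
  have u: "u y = (s\<^sup>2 - (norm (y - c))\<^sup>2) / 2" if "y \<in> \<Omega>" for y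
  proof -
    have "norm ((1/s) *\<^sub>R (y - c)) = norm (y - c) / s" using s by simp
    then show ?thesis using us[OF that] s by (simp only: serrin_u_def) (simp add: power_divide right_diff_distrib)
  qed
  have c: "c \<in> \<Omega>" using s \<Omega> by simp
  have um: "umax \<Omega> u = s\<^sup>2 / 2" unfolding umax_def
    by (rule cSup_eq_maximum) (use u c in \<open>auto intro!: image_eqI[of _ _ c]\<close>)
  have MAX: "MAXset \<Omega> u = {c}"
  proof -
    have "u y = umax \<Omega> u \<longleftrightarrow> y = c" if "y \<in> \<Omega>" for y
      unfolding u[OF that] um by simp
    then show ?thesis using c by (auto simp: MAXset_def)
  qed
  have "connected (ball c s - {c})" using n by (intro connected_punctured_ball) simp
  then have Neq: "N = ball c s - {c}"
    using N MAX \<Omega> unfolding connected_eq_components_subset_sing by auto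
  have "closure N = cball c s"
  proof -
    have "closure (ball c s - {c}) = closure (ball c s)"
    proof (intro equalityI closure_minimal closed_closure)
      show "ball c s - {c} \<subseteq> closure (ball c s)" using closure_subset by blast
      show "ball c s \<subseteq> closure (ball c s - {c})"
      proof
        fix x assume x: "x \<in> ball c s"
        then have "x islimpt ball c s" using interior_limit_point[of x "ball c s"] by (simp add: interior_open)
        moreover have "insert c (ball c s - {c}) = ball c s" using s by auto
        ultimately have "x islimpt (ball c s - {c})" using islimpt_insert[of x c "ball c s - {c}"] by simp
        then show "x \<in> closure (ball c s - {c})" by (simp add: closure_def)
      qed
    qed
    then show ?thesis using s Neq by simp
  qed
  moreover have fr: "frontier \<Omega> = sphere c s" unfolding \<Omega> using s by (simp add: frontier_ball)
  moreover have "sphere c s \<subseteq> cball c s" by (rule sphere_cball)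
  ultimately have F: "frontier \<Omega> \<inter> closure N = sphere c s" by (simp only: Int_absorb2)
  have "connected (sphere c s)" by (rule connected_sphere) (use n in simp)
  moreover have ne: "sphere c s \<noteq> {}" using s by simp
  ultimately have comp: "components (frontier \<Omega> \<inter> closure N) = {sphere c s}"
    unfolding F by (simp add: components_eq_sing_iff)
  obtain G where G: "continuous_on (closure \<Omega>) G" "\<And>x. x \<in> \<Omega> \<Longrightarrow> G x = grad u x"
    "\<And>x. x \<in> frontier \<Omega> \<Longrightarrow> bgrad \<Omega> u x = G x"
    using gradient_extension by metis
  have gr: "grad u x = c - x" if x: "x \<in> \<Omega>" for x
  proof -
    have "partial i u x = c $ i - x $ i" for i
    proof -
      have "has_pd i (\<lambda>y. (1/2) * (s\<^sup>2 - (norm (y - c))\<^sup>2)) ((1/2) * (0 - 2 * (x $ i - c $ i))) x"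
        by (intro has_pd_cmult has_pd_diff has_pd_const has_pd_norm2)
      then have 1: "((\<lambda>t. (1/2) * (s\<^sup>2 - (norm (x + t *\<^sub>R axis i 1 - c))\<^sup>2)) has_real_derivative c $ i - x $ i) (at 0)"
        by (simp add: has_pd_def diff_divide_distrib)
      obtain d where d: "d > 0" "ball x d \<subseteq> \<Omega>" using opn x openE by blast
      \<comment> \<open>The formula for u is known only inside \<Omega>, so its derivative is
        transferred through equality near the point.\<close>
      have ev: "\<forall>\<^sub>F t in nhds 0. (1/2) * (s\<^sup>2 - (norm (x + t *\<^sub>R axis i 1 - c))\<^sup>2) = u (x + t *\<^sub>R axis i 1)"
        unfolding eventually_nhds_metric
      proof (intro exI[of _ d] conjI allI impI)
        fix t :: real assume "dist t 0 < d"
        then have "x + t *\<^sub>R axis i 1 \<in> ball x d" by (simp add: dist_norm)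
        then show "(1/2) * (s\<^sup>2 - (norm (x + t *\<^sub>R axis i 1 - c))\<^sup>2) = u (x + t *\<^sub>R axis i 1)"
          using d(2) u[of "x + t *\<^sub>R axis i 1"] by auto
      qed (rule d(1))
      have "((\<lambda>t. u (x + t *\<^sub>R axis i 1)) has_real_derivative c $ i - x $ i) (at 0)"
        using DERIV_cong_ev[OF refl ev refl] 1 by (rule iffD1)
      then show ?thesis by (rule DERIV_unique[OF pd1[OF x, of i, unfolded has_pd_def]])
    qed
    then show ?thesis by (simp add: grad_def vec_eq_iff)
  qed
  \<comment> \<open>The continuous extension agrees with c - x on \<Omega>, hence on the
    closure.\<close>
  have bg: "bgrad \<Omega> u x = c - x" if x: "x \<in> sphere c s" for x
  proof -
    have xf: "x \<in> frontier \<Omega>" using x unfolding fr .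
    then have xc: "x \<in> closure \<Omega>" unfolding frontier_def by blast
    have cont: "continuous_on (closure \<Omega>) (\<lambda>x. norm (G x - (c - x)))"
      by (intro continuous_intros G(1))
    have "norm (G x - (c - x)) \<le> 0"
      by (rule continuous_le_on_closure[OF cont xc]) (simp add: G(2) gr)
    then show ?thesis using G(3)[OF xf] by simp
  qed
  have "norm (bgrad \<Omega> u x) = s" if "x \<in> sphere c s" for x
    using that unfolding bg[OF that] by (simp add: dist_norm)
  then have "(\<lambda>p. norm (bgrad \<Omega> u p)) ` sphere c s = (\<lambda>p. s) ` sphere c s" by (rule image_cong[OF refl])
  then have "(\<lambda>p. norm (bgrad \<Omega> u p)) ` sphere c s = {s}" using ne by (simp only: image_constant_conv if_False)
  then have "nwss_bdry \<Omega> u (sphere c s) = 1" using s by (simp add: nwss_bdry_def um)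
  then show ?thesis by (simp add: nwss_def comp)
qed

end

theorem theorem2p1:
  fixes \<Omega> :: "(real^'n::finite) set" and u :: "real^'n \<Rightarrow> real" and N :: "(real^'n) set"
  assumes "CARD('n) \<ge> 3"
    and "smooth_bounded_domain \<Omega>"
    and "torsion_solution \<Omega> u"
    and "N \<in> components (\<Omega> - MAXset \<Omega> u)"
  shows "nwss \<Omega> u N \<ge> 1
     \<and> core_radius CARD('n) (nwss \<Omega> u N) \<ge> 0
     \<and> (core_radius CARD('n) (nwss \<Omega> u N) = 0
          \<longleftrightarrow> equivalent_sol (ball 0 1) serrin_u \<Omega> u)"
proof -
  interpret torsion \<Omega> u
    using assms(2,3) by unfold_locales (auto simp: smooth_bounded_domain_def)
  have n: "CARD('n) \<ge> 2" using assms(1) by simp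
  have eqv: "equivalent_sol (ball 0 1) serrin_u \<Omega> u" if "nwss \<Omega> u N \<le> 1"
    by (rule equivalent_serrin_of_nwss_le_1[OF n assms(4) that])
  have one: "nwss \<Omega> u N = 1" if "equivalent_sol (ball 0 1) serrin_u \<Omega> u"
    by (rule nwss_eq_1_of_equivalent_serrin[OF n assms(4) that])
  \<comment> \<open>A value below 1 would give the Serrin solution by \<open>eqv\<close>, and then
    the value 1 by \<open>one\<close>.\<close>
  have ge: "nwss \<Omega> u N \<ge> 1" using eqv one by fastforce
  have "nwss \<Omega> u N = 1 \<longleftrightarrow> equivalent_sol (ball 0 1) serrin_u \<Omega> u" using eqv one by fastforce
  then show ?thesis using ge core_radius_nonneg_and_zero_iff[OF assms(1) ge] by simp
qed

end
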